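(* Let $\mathcal{A}^\star$ be the mod 2 motivic Steenrod algebra over a base scheme with no points of residue characteristic two, let $\operatorname{Sq}^{i}$ be the motivic Steenrod squares, let $Q_i$ and $\mathcal{P}^i$ in $\mathcal{A}^\star$ be the elements of the Milnor basis dual to $\tau_i$ and $\xi_i$ respectively, let $\widehat{\xi_1^{2^n}\xi_n}$ be the element of the Milnor basis dual to the monomial $\xi_1^{2^n}\xi_n$, and let $\tau\in H^{0,1}$ be the generator and $\rho\in H^{1,1}$ the class of $-1$. Then for every integer $n \geq 1$ the following equality holds in $\mathcal{A}^\star$: \[ \begin{aligned} \operatorname{Sq}^{2^{n+1}}\mathcal{P}^n = {}& \mathcal{P}^{n+1} + \widehat{\xi_1^{2^n}\xi_n} + \tau \sum_{i=0}^{n-1}\rho^{i}\,Q_{n-i-1}Q_{n-i}\cdots Q_n \operatorname{Sq}^{2^{n-i}} \\ & + \tau \rho \sum_{i=0}^{n-1}\rho^{i}\,Q_{n-i-1}Q_{n-i}\cdots Q_n\, Q_0 \operatorname{Sq}^{2^{n-i} - 2}, \end{aligned} \] where $Q_{n-i-1}Q_{n-i}\cdots Q_n$ denotes the product of all $Q_j$ with $n-i-1\le j\le n$.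
   Context: Base: a base scheme $S$ with no points of residue characteristic two (for instance $S=\operatorname{Spec} k$, $k$ a field with $\operatorname{char} k\neq 2$, or an essentially smooth scheme over such a field). $H^\star=H^{\star}(S;\mathbb{Z}/2)$ is the bigraded mod 2 motivic cohomology of the base, and $H_\star:=H^{-\star}$. $\tau$ is the generator of $H^{0,1}$ (over a field $H^{0,1}\cong\mu_2(k)$), and $\rho\in H^{1,1}$ is the class of $-1$ (over a field $H^{1,1}\cong k^\times/(k^\times)^2$). The mod 2 motivic Steenrod algebra $\mathcal{A}^\star$ is the $H^\star$-algebra of bistable operations on mod 2 motivic cohomology; it is generated over $H^\star$ by the motivic Steenrod squares $\operatorname{Sq}^i$ ($\operatorname{Sq}^0=1$, $\operatorname{Sq}^1$ the Bockstein), and is a free left $H^\star$-module on the admissible monomials in the $\operatorname{Sq}^i$. Its dual is $\mathcal{A}_\star:=\operatorname{Hom}(\mathcal{A}^\star,H^\star)$ (left $H^\star$-linear maps), and \[ \mathcal{A}_\star \cong H_\star[\tau_0,\tau_1,\ldots,\xi_1,\xi_2,\ldots]\big/\big(\tau_i^2+\tau\xi_{i+1}+\rho(\tau_{i+1}+\tau_0\xi_{i+1}),\ i\ge 0\big), \] with $|\tau_i|=(2^{i+1}-1,2^i-1)$ and $|\xi_i|=(2^{i+1}-2,2^i-1)$. It is a Hopf algebroid with $\eta_L(x)=\eta_R(x)=x$ for $x\in H^{1,1}=H_{-1,-1}$, $\eta_L\tau=\tau$, $\eta_R\tau=\tau+\rho\tau_0$, $\epsilon\tau_i=0$ for $i\geq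 0$, $\epsilon\xi_i=0$ for $i\geq 1$, $\Delta x = x\otimes 1$ for $x\in H_\star$, and, with $\xi_0=1$, \[ \Delta\xi_k=\sum_{i=0}^k\xi_{k-i}^{2^i}\otimes\xi_i,\qquad \Delta\tau_k=\tau_k\otimes 1+\sum_{i=0}^k\xi_{k-i}^{2^i}\otimes\tau_i . \] Here $\Delta:\mathcal{A}_\star\to\mathcal{A}_\star\otimes_{r,l}\mathcal{A}_\star$, the tensor product using the right module structure (via $\eta_R$) on the first factor and the left one (via $\eta_L$) on the second. With $\langle\alpha,\theta\rangle:=\alpha(\theta)\in H^\star$, the product of $\mathcal{A}^\star$ is related to $\Delta$ by $\langle\alpha,\theta_1\theta_2\rangle=[\Delta\alpha,\theta_1\otimes\theta_2]$, where $[\alpha_1\otimes\alpha_2,\theta_1\otimes\theta_2]:=\langle\alpha_1,\theta_1\langle\alpha_2,\theta_2\rangle\rangle$. $\mathcal{A}_\star$ is a free left $H_\star$-module on the monomials $\tau(E)\xi(R)=\prod_i\tau_i^{\epsilon_i}\prod_i\xi_i^{r_i}$, where $E=(\epsilon_0,\epsilon_1,\dots)$ with $\epsilon_i\in\{0,1\}$ and $R=(r_1,r_2,\dots)$ with $r_i\ge0$ are finite sequences. The dual basis $\{\widehat{\tau(E)\xi(R)}\}$ of $\mathcal{A}^\star$ is called the Milnor basis. Set $Q_i:=\widehat{\tau_i}$, $\mathcal{P}^R:=\widehat{\xi(R)}$ for a sequence $R$, and $\mathcal{P}^i:=\widehat{\xi_i}$ for an integer $i\ge1$. Known facts: $Q_0=\operatorname{Sq}^1$,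 $\operatorname{Sq}^{2m}=\widehat{\xi_1^m}$ (so $\mathcal{P}^1=\operatorname{Sq}^2$), $\widehat{\tau(E)\xi(R)}=\big(\prod_i Q_i^{\epsilon_i}\big)\mathcal{P}^R$, $Q_iQ_j=Q_jQ_i$ and $Q_i^2=0$. *)

theory Defs
  imports Main
begin

text \<open>
  For ring maps \<open>r, l : H \<rightarrow> D\<close> the tensor product \<open>D \<otimes>\<^bsub>r,l\<^esub> D\<close> is the group of formal sums of
  pairs (here: lists) modulo the congruence below; \<open>balanced\<close> identifies \<open>a \<cdot> r h \<otimes> b\<close> with
  \<open>a \<otimes> l h \<cdot> b\<close>. Negatives are present: \<open>(- a, b)\<close> is inverse to \<open>(a, b)\<close> by \<open>add_left\<close> and \<open>zero\<close>.
\<close>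

inductive tensor_eq ::
    "('h \<Rightarrow> 'd::comm_ring_1) \<Rightarrow> ('h \<Rightarrow> 'd) \<Rightarrow> ('d \<times> 'd) list \<Rightarrow> ('d \<times> 'd) list \<Rightarrow> bool"
  for r l where
  refl: "tensor_eq r l xs xs"
| sym: "tensor_eq r l xs ys \<Longrightarrow> tensor_eq r l ys xs"
| trans: "tensor_eq r l xs ys \<Longrightarrow> tensor_eq r l ys zs \<Longrightarrow> tensor_eq r l xs zs"
| append: "tensor_eq r l xs xs' \<Longrightarrow> tensor_eq r l ys ys' \<Longrightarrow> tensor_eq r l (xs @ ys) (xs' @ ys')"
| commute: "tensor_eq r l (xs @ ys) (ys @ xs)"
| zero: "tensor_eq r l [(0, b)] []"
| add_left: "tensor_eq r l [(a + a', b)] [(a, b), (a', b)]"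
| add_right: "tensor_eq r l [(a, b + b')] [(a, b), (a, b')]"
| balanced: "tensor_eq r l [(a * r h, b)] [(a, l h * b)]"

definition unital_ring_hom :: "('r::ring_1 \<Rightarrow> 's::ring_1) \<Rightarrow> bool" where
  "unital_ring_hom f \<longleftrightarrow>
     f 1 = 1 \<and> (\<forall>x y. f (x + y) = f x + f y) \<and> (\<forall>x y. f (x * y) = f x * f y)"

definition tensor_sum ::
    "('d \<Rightarrow> 't::comm_ring_1) \<Rightarrow> ('d \<Rightarrow> 't) \<Rightarrow> ('d \<times> 'd) list \<Rightarrow> 't" where
  "tensor_sum i1 i2 xs = (\<Sum>(a, b)\<leftarrow>xs. i1 a * i2 b)"

text \<open>
  The ring \<open>'t\<close>, with \<open>i1 a = a \<otimes> 1\<close> and \<open>i2 b = 1 \<otimes> b\<close>, is the tensor product: formal sums modulo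
  the congruence, with multiplication \<open>(a \<otimes> b) (c \<otimes> d) = a c \<otimes> b d\<close>.
\<close>

definition is_tensor_product ::
    "('h \<Rightarrow> 'd::comm_ring_1) \<Rightarrow> ('h \<Rightarrow> 'd) \<Rightarrow> ('d \<Rightarrow> 't::comm_ring_1) \<Rightarrow> ('d \<Rightarrow> 't) \<Rightarrow> bool" where
  "is_tensor_product r l i1 i2 \<longleftrightarrow>
     unital_ring_hom i1 \<and> unital_ring_hom i2 \<and>
     (\<forall>t. \<exists>xs. t = tensor_sum i1 i2 xs) \<and>
     (\<forall>xs ys. tensor_sum i1 i2 xs = tensor_sum i1 i2 ys \<longleftrightarrow> tensor_eq r l xs ys)"

definition bigrading :: "(int \<Rightarrow> int \<Rightarrow> 'r::ring_1 set) \<Rightarrow> bool" where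
  "bigrading G \<longleftrightarrow>
     (\<forall>p q. 0 \<in> G p q \<and> (\<forall>x\<in>G p q. \<forall>y\<in>G p q. x - y \<in> G p q)) \<and>
     1 \<in> G 0 0 \<and>
     (\<forall>p q p' q'. \<forall>x\<in>G p q. \<forall>y\<in>G p' q'. x * y \<in> G (p + p') (q + q')) \<and>
     (\<forall>x. \<exists>!c. finite {d. c d \<noteq> 0} \<and> (\<forall>d. c d \<in> G (fst d) (snd d)) \<and> x = (\<Sum>d | c d \<noteq> 0. c d))"

text \<open>
  The types \<open>'h\<close>, \<open>'d\<close>, \<open>'t\<close>, \<open>'a\<close> are the total rings of the cohomology of the base, of the dual
  Steenrod algebra, of its tensor square, and of the Steenrod algebra. Cohomology is indexed
  cohomologically, so \<open>H_{p,q}\<close> is \<open>Coh (-p) (-q)\<close>. \<open>scalar\<close> is the (non-central) inclusion of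
  the cohomology of the base into the Steenrod algebra.
\<close>

record ('h, 'd, 't, 'a) steenrod_data =
  Coh :: "int \<Rightarrow> int \<Rightarrow> 'h set"
  DualSt :: "int \<Rightarrow> int \<Rightarrow> 'd set"
  St :: "int \<Rightarrow> int \<Rightarrow> 'a set"
  tau :: 'h
  rho :: 'h
  scalar :: "'h \<Rightarrow> 'a"
  Sq :: "nat \<Rightarrow> 'a"
  pairing :: "'d \<Rightarrow> 'a \<Rightarrow> 'h"
  etaL :: "'h \<Rightarrow> 'd"
  etaR :: "'h \<Rightarrow> 'd"
  counit :: "'d \<Rightarrow> 'h"
  tensL :: "'d \<Rightarrow> 't"
  tensR :: "'d \<Rightarrow> 't"
  Delta :: "'d \<Rightarrow> 't"
  taus :: "nat \<Rightarrow> 'd"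
  xis :: "nat \<Rightarrow> 'd"

text \<open>
  A pair \<open>(E, R)\<close> indexes \<open>\<tau>(E) \<xi>(R)\<close>: the set \<open>E\<close> consists of the \<open>i\<close> with \<open>\<epsilon>\<^sub>i = 1\<close>, and \<open>R i = r\<^sub>i\<close>,
  where \<open>R 0 = 0\<close> because there is no generator \<open>\<xi>\<^sub>0\<close>.
\<close>

definition monomial_indices :: "(nat set \<times> (nat \<Rightarrow> nat)) set" where
  "monomial_indices = {(E, R). finite E \<and> finite {i. R i \<noteq> 0} \<and> R 0 = 0}"

definition monomial ::
    "('h, 'd::comm_ring_1, 't, 'a) steenrod_data \<Rightarrow> nat set \<times> (nat \<Rightarrow> nat) \<Rightarrow> 'd" where
  "monomial M = (\<lambda>(E, R). (\<Prod>i\<in>E. taus M i) * (\<Prod>i | R i \<noteq> 0. xis M i ^ R i))"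

definition monomials :: "('h, 'd::comm_ring_1, 't, 'a) steenrod_data \<Rightarrow> 'd set" where
  "monomials M = monomial M ` monomial_indices"

text \<open>Meaningful for \<open>b \<in> monomials M\<close>: the element \<open>\<theta>\<close> of the Milnor basis dual to \<open>b\<close>.\<close>

definition dual_elem :: "('h::comm_ring_1, 'd::comm_ring_1, 't, 'a) steenrod_data \<Rightarrow> 'd \<Rightarrow> 'a" where
  "dual_elem M b =
     (THE \<theta>. \<forall>b'\<in>monomials M. pairing M b' \<theta> = (if b' = b then 1 else 0))"

definition milnor_Q :: "('h::comm_ring_1, 'd::comm_ring_1, 't, 'a) steenrod_data \<Rightarrow> nat \<Rightarrow> 'a" where
  "milnor_Q M i = dual_elem M (taus M i)"

definition milnor_P :: "('h::comm_ring_1, 'd::comm_ring_1, 't, 'a) steenrod_data \<Rightarrow> nat \<Rightarrow> 'a" where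
  "milnor_P M i = dual_elem M (xis M i)"

text \<open>
  Motivic cohomology of schemes is not available, so the Steenrod algebra over a base is given by
  the structure that Voevodsky's theorem and its extensions to general bases provide: the dual
  Hopf algebroid by generators, relations and structure maps, and the Steenrod algebra by its
  duality with it. The generators are characterised by the relations together with freeness
  on the monomials, which amounts to the presentation as a quotient of a polynomial ring. The
  element \<open>\<rho>\<close> is pinned down as the class of \<open>-1\<close> by \<open>etaR_tau\<close>, which expresses that it is the
  Bockstein of \<open>\<tau>\<close>. Apart from \<open>etaR_rho\<close> and \<open>etaR_tau\<close>, the right unit (equivalently, the action
  of the Steenrod algebra on the cohomology of the base) depends on the base and is left arbitrary.
\<close>

locale motivic_steenrod =
  fixes M :: "('h::comm_ring_1, 'd::comm_ring_1, 't::comm_ring_1, 'a::ring_1) steenrod_data"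
  assumes char_two: "(1::'h) + 1 = 0"
    and bigrading_Coh: "bigrading (Coh M)"
    and tau_degree: "tau M \<in> Coh M 0 1"
    and tau_generator: "\<And>x. x \<in> Coh M 0 1 \<Longrightarrow> \<exists>y\<in>Coh M 0 0. x = y * tau M"
    and rho_degree: "rho M \<in> Coh M 1 1"

    and bigrading_DualSt: "bigrading (DualSt M)"
    and etaL_hom: "unital_ring_hom (etaL M)"
    and etaR_hom: "unital_ring_hom (etaR M)"
    and etaL_degree: "\<And>p q x. x \<in> Coh M p q \<Longrightarrow> etaL M x \<in> DualSt M (- p) (- q)"
    and etaR_degree: "\<And>p q x. x \<in> Coh M p q \<Longrightarrow> etaR M x \<in> DualSt M (- p) (- q)"
    and taus_degree: "\<And>i. taus M i \<in> DualSt M (2 ^ (i + 1) - 1) (2 ^ i - 1)"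
    and xis_degree: "\<And>i. xis M i \<in> DualSt M (2 ^ (i + 1) - 2) (2 ^ i - 1)"
    and xis_0: "xis M 0 = 1"
    and relation: "\<And>i. taus M i ^ 2 + etaL M (tau M) * xis M (i + 1)
      + etaL M (rho M) * (taus M (i + 1) + taus M 0 * xis M (i + 1)) = 0"
    and free: "\<And>\<alpha>. \<exists>!c. finite {m. c m \<noteq> 0} \<and> {m. c m \<noteq> 0} \<subseteq> monomial_indices \<and>
      \<alpha> = (\<Sum>m | c m \<noteq> 0. etaL M (c m) * monomial M m)"

    and etaR_rho: "\<And>x. x \<in> Coh M 1 1 \<Longrightarrow> etaR M x = etaL M x"
    and etaR_tau: "etaR M (tau M) = etaL M (tau M) + etaL M (rho M) * taus M 0"
    and counit_hom: "unital_ring_hom (counit M)"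
    and counit_etaL: "\<And>x. counit M (etaL M x) = x"
    and counit_etaR: "\<And>x. counit M (etaR M x) = x"
    and counit_taus: "\<And>i. counit M (taus M i) = 0"
    and counit_xis: "\<And>i. i \<ge> 1 \<Longrightarrow> counit M (xis M i) = 0"
    and tensor: "is_tensor_product (etaR M) (etaL M) (tensL M) (tensR M)"
    and Delta_hom: "unital_ring_hom (Delta M)"
    and Delta_etaL: "\<And>x. Delta M (etaL M x) = tensL M (etaL M x)"
    and Delta_etaR: "\<And>x. Delta M (etaR M x) = tensR M (etaR M x)"
    and Delta_xis: "\<And>k. Delta M (xis M k)
      = (\<Sum>i\<le>k. tensL M (xis M (k - i) ^ 2 ^ i) * tensR M (xis M i))"
    and Delta_taus: "\<And>k. Delta M (taus M k) = tensL M (taus M k)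
      + (\<Sum>i\<le>k. tensL M (xis M (k - i) ^ 2 ^ i) * tensR M (taus M i))"

    and bigrading_St: "bigrading (St M)"
    and scalar_hom: "unital_ring_hom (scalar M)"
    and scalar_degree: "\<And>p q x. x \<in> Coh M p q \<Longrightarrow> scalar M x \<in> St M p q"
    and pairing_degree: "\<And>p q p' q' \<alpha> \<theta>. \<alpha> \<in> DualSt M p q \<Longrightarrow> \<theta> \<in> St M p' q' \<Longrightarrow>
      pairing M \<alpha> \<theta> \<in> Coh M (p' - p) (q' - q)"
    and pairing_add_left: "\<And>\<alpha> \<beta> \<theta>. pairing M (\<alpha> + \<beta>) \<theta> = pairing M \<alpha> \<theta> + pairing M \<beta> \<theta>"
    and pairing_add_right: "\<And>\<alpha> \<theta> \<theta>'. pairing M \<alpha> (\<theta> + \<theta>') = pairing M \<alpha> \<theta> + pairing M \<alpha> \<theta>'"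
    and pairing_scalar: "\<And>x \<alpha> \<theta>. pairing M \<alpha> (scalar M x * \<theta>) = x * pairing M \<alpha> \<theta>"
    and pairing_etaL: "\<And>x \<alpha> \<theta>. pairing M (etaL M x * \<alpha>) \<theta> = x * pairing M \<alpha> \<theta>"
    and pairing_etaR: "\<And>x \<alpha> \<theta>. pairing M (\<alpha> * etaR M x) \<theta> = pairing M \<alpha> (\<theta> * scalar M x)"
    and pairing_one: "\<And>\<alpha>. pairing M \<alpha> 1 = counit M \<alpha>"
    and pairing_mult: "\<And>\<alpha> \<theta>\<^sub>1 \<theta>\<^sub>2 xs. Delta M \<alpha> = tensor_sum (tensL M) (tensR M) xs \<Longrightarrow>
      pairing M \<alpha> (\<theta>\<^sub>1 * \<theta>\<^sub>2)
        = (\<Sum>(\<alpha>\<^sub>1, \<alpha>\<^sub>2)\<leftarrow>xs. pairing M \<alpha>\<^sub>1 (\<theta>\<^sub>1 * scalar M (pairing M \<alpha>\<^sub>2 \<theta>\<^sub>2)))"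

    \<comment> \<open>by the next three, the Milnor basis exists and is a basis of the left module of operations\<close>
    and dual_exists: "\<And>b. b \<in> monomials M \<Longrightarrow>
      \<exists>\<theta>. \<forall>b'\<in>monomials M. pairing M b' \<theta> = (if b' = b then 1 else 0)"
    and pairing_finite: "\<And>\<theta>. finite {b \<in> monomials M. pairing M b \<theta> \<noteq> 0}"
    and pairing_nondegenerate: "\<And>\<theta>. (\<And>b. b \<in> monomials M \<Longrightarrow> pairing M b \<theta> = 0) \<Longrightarrow> \<theta> = 0"

    and Sq_0: "Sq M 0 = 1"
    and Sq_1: "Sq M 1 = milnor_Q M 0"
    and Sq_even: "\<And>m. Sq M (2 * m) = dual_elem M (xis M 1 ^ m)"
    and Sq_odd: "\<And>m. Sq M (2 * m + 1) = Sq M 1 * Sq M (2 * m)"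

end

theory Submission
  imports Defs HOL.Modules
begin

text \<open>
  Both sides are compared by pairing with the monomials \<open>\<tau>(E) \<xi>(R)\<close>. For a fixed operation \<open>\<theta>\<close>,
  contraction \<open>\<alpha>\<^sub>1 \<otimes> \<alpha>\<^sub>2 \<mapsto> \<alpha>\<^sub>1 \<eta>\<^sub>R\<langle>\<alpha>\<^sub>2, \<theta>\<rangle>\<close> gives a left linear map on the tensor square, and
  \<open>\<langle>\<alpha>, \<theta>' \<theta>\<rangle>\<close> is the \<open>\<theta>'\<close>-coefficient of the contraction of \<open>\<Delta> \<alpha>\<close>. For \<open>\<theta>' = Sq\<^bsup>2 ^ (n+1)\<^esup>\<close>, the
  dual of a power of \<open>\<xi>\<^sub>1\<close>, one may calculate modulo \<open>\<xi>\<^sub>j\<close> (\<open>j \<ge> 2\<close>) and \<open>\<tau>\<^sub>j\<close> (\<open>j \<ge> 1\<close>) in the first factor,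
  where \<open>\<Delta> \<tau>\<^sub>e\<close> is \<open>1 \<otimes> \<tau>\<^sub>e\<close> plus \<open>\<xi>\<^sub>1 ^ 2 ^ (e-1) \<otimes> \<tau>\<^sub>e\<^sub>-\<^sub>1\<close>. In a product of these, \<open>\<xi>\<^sub>n\<close> arises in the second
  factor only through a chain of carries \<open>\<tau>\<^sub>e\<^sup>2 \<leadsto> \<rho> \<tau>\<^sub>e\<^sub>+\<^sub>1\<close> that runs from some \<open>e\<close> to \<open>n - 1\<close> without a gap and
  ends with \<open>\<tau>\<^sup>2\<^sub>n\<^sub>-\<^sub>1 \<leadsto> \<tau> \<xi>\<^sub>n\<close>; this forces \<open>E = {e..n}\<close>. The coefficient \<open>\<tau>\<close> moves to the first factor
  as \<open>\<eta>\<^sub>R \<tau> = \<tau> + \<rho> \<tau>\<^sub>0\<close>, whose second summand accounts for the terms with an additional \<open>Q\<^sub>0\<close>.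
\<close>

subsection \<open>Ring homomorphisms and ideals\<close>

lemma unital_ring_homD:
  assumes "unital_ring_hom f"
  shows "f 1 = 1" "f (x + y) = f x + f y" "f (x * y) = f x * f y"
  using assms by (auto simp: unital_ring_hom_def)

lemma unital_ring_hom_zero: "unital_ring_hom f \<Longrightarrow> f 0 = 0"
  using unital_ring_homD(2)[of f 0 0] by simp

lemma unital_ring_hom_minus: "unital_ring_hom f \<Longrightarrow> f (- x) = - f x"
  using unital_ring_homD(2)[of f "- x" x] unital_ring_hom_zero[of f]
  by (simp add: eq_neg_iff_add_eq_0)

lemma unital_ring_hom_power: "unital_ring_hom f \<Longrightarrow> f (x ^ k) = f x ^ k"
  by (induction k) (simp_all add: unital_ring_homD)

lemma unital_ring_hom_prod:
  fixes f :: "'r::comm_ring_1 \<Rightarrow> 's::comm_ring_1"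
  shows "unital_ring_hom f \<Longrightarrow> f (prod g A) = (\<Prod>a\<in>A. f (g a))"
  by (induction A rule: infinite_finite_induct) (simp_all add: unital_ring_homD)

text \<open>With the ring as a module over itself, submodules are ideals, so
  \<open>ideal.span X\<close> is the ideal generated by \<open>X\<close>.\<close>

interpretation ideal: module "(*) :: 'r \<Rightarrow> 'r \<Rightarrow> 'r::comm_ring_1"
  by unfold_locales (simp_all add: algebra_simps)

\<comment> \<open>as a rewrite rule it loops against associativity\<close>
declare ideal.scale_scale [simp del]

definition cong_ideal :: "'r::comm_ring_1 set \<Rightarrow> 'r \<Rightarrow> 'r \<Rightarrow> bool" where
  "cong_ideal X a b \<longleftrightarrow> a - b \<in> ideal.span X"

lemma cong_ideal_refl [simp]: "cong_ideal X a a"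
  by (simp add: cong_ideal_def ideal.span_zero)

lemma cong_ideal_add:
  assumes "cong_ideal X a b" "cong_ideal X c d"
  shows "cong_ideal X (a + c) (b + d)"
  using ideal.span_add[OF assms[unfolded cong_ideal_def]]
  by (simp add: cong_ideal_def algebra_simps)

lemma cong_ideal_sum:
  "(\<And>i. i \<in> A \<Longrightarrow> cong_ideal X (f i) (g i)) \<Longrightarrow> cong_ideal X (sum f A) (sum g A)"
  by (induction A rule: infinite_finite_induct) (simp_all add: cong_ideal_add)

lemma cong_ideal_mult:
  assumes "cong_ideal X a b" "cong_ideal X c d"
  shows "cong_ideal X (a * c) (b * d)"
proof -
  have "a * c - b * d = c * (a - b) + b * (c - d)"
    by (simp add: algebra_simps)
  then show ?thesis
    using assms by (simp add: cong_ideal_def ideal.span_add ideal.span_scale)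
qed

lemma cong_ideal_prod:
  "(\<And>i. i \<in> A \<Longrightarrow> cong_ideal X (f i) (g i)) \<Longrightarrow> cong_ideal X (prod f A) (prod g A)"
  by (induction A rule: infinite_finite_induct) (simp_all add: cong_ideal_mult)

lemma cong_ideal_power: "cong_ideal X a b \<Longrightarrow> cong_ideal X (a ^ k) (b ^ k)"
  by (induction k) (simp_all add: cong_ideal_mult)

lemma cong_ideal_zero: "x \<in> X \<Longrightarrow> cong_ideal X (y * x) 0"
  by (simp add: cong_ideal_def ideal.span_base ideal.span_scale)

subsection \<open>Monomials and the Milnor basis\<close>

context motivic_steenrod
begin

lemmas etaL_simps [simp] = unital_ring_homD[OF etaL_hom] unital_ring_hom_zero[OF etaL_hom]
  unital_ring_hom_power[OF etaL_hom]
lemmas etaR_simps [simp] = unital_ring_homD[OF etaR_hom] unital_ring_hom_zero[OF etaR_hom]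
  unital_ring_hom_power[OF etaR_hom]
lemmas counit_simps [simp] = unital_ring_homD[OF counit_hom] unital_ring_hom_zero[OF counit_hom]
  unital_ring_hom_power[OF counit_hom]
lemmas scalar_simps [simp] = unital_ring_homD[OF scalar_hom] unital_ring_hom_zero[OF scalar_hom]

lemma tensL_hom: "unital_ring_hom (tensL M)" and tensR_hom: "unital_ring_hom (tensR M)"
  using tensor by (auto simp: is_tensor_product_def)

lemmas tensL_simps [simp] = unital_ring_homD[OF tensL_hom] unital_ring_hom_zero[OF tensL_hom]
  unital_ring_hom_power[OF tensL_hom]
lemmas tensR_simps [simp] = unital_ring_homD[OF tensR_hom] unital_ring_hom_zero[OF tensR_hom]
  unital_ring_hom_power[OF tensR_hom]

lemma uminus_H: "- h = (h::'h)"
  using char_two by (metis add.inverse_unique distrib_left mult.right_neutral mult_zero_right)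

text \<open>Characteristic two is inherited along the unital map \<open>etaL\<close>.\<close>

lemma uminus_D: "- a = (a::'d)"
proof -
  have "etaL M (- 1) * a = etaL M 1 * a"
    by (simp only: uminus_H)
  then show ?thesis
    by (simp add: unital_ring_hom_minus[OF etaL_hom])
qed

lemma taus_square:
  "taus M i * taus M i = etaL M (tau M) * xis M (Suc i)
    + etaL M (rho M) * taus M (Suc i) + etaL M (rho M) * taus M 0 * xis M (Suc i)"
proof -
  let ?s = "etaL M (tau M) * xis M (Suc i)
    + etaL M (rho M) * taus M (Suc i) + etaL M (rho M) * taus M 0 * xis M (Suc i)"
  have "taus M i * taus M i + ?s = 0"
    using relation[of i] by (simp add: power2_eq_square algebra_simps)
  then have "taus M i * taus M i = - ?s"
    by (simp only: eq_neg_iff_add_eq_0)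
  then show ?thesis
    by (simp only: uminus_D)
qed

section \<open>Additivity of the pairing and uniqueness of the Milnor basis\<close>

lemma pairing_zero_left [simp]: "pairing M 0 \<theta> = 0"
  using pairing_add_left[of 0 0 \<theta>] by simp

lemma pairing_zero_right [simp]: "pairing M \<alpha> 0 = 0"
  using pairing_add_right[of \<alpha> 0 0] by simp

lemma pairing_diff_right: "pairing M \<alpha> (\<theta> - \<theta>') = pairing M \<alpha> \<theta> - pairing M \<alpha> \<theta>'"
  using pairing_add_right[of \<alpha> "\<theta> - \<theta>'" \<theta>'] by simp

lemma pairing_diff_left: "pairing M (\<alpha> - \<beta>) \<theta> = pairing M \<alpha> \<theta> - pairing M \<beta> \<theta>"
  using pairing_add_left[of "\<alpha> - \<beta>" \<beta> \<theta>] by simp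

lemma pairing_sum_left: "pairing M (sum f A) \<theta> = (\<Sum>i\<in>A. pairing M (f i) \<theta>)"
  by (induction A rule: infinite_finite_induct) (simp_all add: pairing_add_left)

lemma pairing_sum_right: "pairing M \<alpha> (sum f A) = (\<Sum>i\<in>A. pairing M \<alpha> (f i))"
  by (induction A rule: infinite_finite_induct) (simp_all add: pairing_add_right)

lemma steenrod_eqI:
  assumes "\<And>m. m \<in> monomial_indices \<Longrightarrow> pairing M (monomial M m) \<theta> = pairing M (monomial M m) \<theta>'"
  shows "\<theta> = \<theta>'"
proof -
  have "\<theta> - \<theta>' = 0"
    by (rule pairing_nondegenerate) (auto simp: assms pairing_diff_right monomials_def)
  then show ?thesis by simp
qed

text \<open>The definite description in \<open>dual_elem\<close> is meaningful: existence is an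
  axiom, and uniqueness holds because the monomials separate operations.\<close>

lemma pairing_dual_elem:
  assumes "b \<in> monomials M" "b' \<in> monomials M"
  shows "pairing M b' (dual_elem M b) = (if b' = b then 1 else 0)"
proof -
  have "\<exists>!\<theta>. \<forall>b'\<in>monomials M. pairing M b' \<theta> = (if b' = b then 1 else 0)"
    by (rule ex_ex1I[OF dual_exists[OF assms(1)]])
      (rule steenrod_eqI, auto simp: monomials_def)
  from theI'[OF this] show ?thesis
    using assms(2) unfolding dual_elem_def by blast
qed

text \<open>Freeness writes every element as a finite left combination of monomials, so an additive
  property can be checked on single terms. Zero is the term with \<open>c = 0\<close>.\<close>

lemma dual_induct [case_names add monomial]:
  assumes add: "\<And>\<alpha> \<beta>. P \<alpha> \<Longrightarrow> P \<beta> \<Longrightarrow> P (\<alpha> + \<beta>)"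
    and monomial: "\<And>c E R. (E, R) \<in> monomial_indices \<Longrightarrow> P (etaL M c * monomial M (E, R))"
  shows "P \<alpha>"
proof -
  obtain c where c: "{m. c m \<noteq> 0} \<subseteq> monomial_indices"
    "\<alpha> = (\<Sum>m | c m \<noteq> 0. etaL M (c m) * monomial M m)"
    using ex1_implies_ex[OF free[of \<alpha>]] by (elim exE conjE) (rule that)
  have "P 0"
    using monomial[of "{}" "\<lambda>_. 0" 0] by (simp add: monomial_indices_def)
  then have "P (\<Sum>m\<in>A. etaL M (c m) * monomial M m)" if "A \<subseteq> monomial_indices" for A
    using that by (induction A rule: infinite_finite_induct) (auto intro!: add monomial)
  with c show ?thesis by blast
qed

section \<open>Arithmetic of monomials and of their index pairs\<close>

lemma monomial_eq:
  assumes "finite S" "{i. R i \<noteq> 0} \<subseteq> S"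
  shows "monomial M (E, R) = prod (taus M) E * (\<Prod>i\<in>S. xis M i ^ R i)"
  unfolding monomial_def split
  by (rule arg_cong[where f = "(*) _"], rule prod.mono_neutral_left) (use assms in auto)

lemma monomial_zero [simp]: "monomial M ({}, \<lambda>_. 0) = 1"
  by (simp add: monomial_def)

lemma monomial_no_xi: "monomial M (E, \<lambda>_. 0) = prod (taus M) E"
  by (simp add: monomial_def)

lemma taus_mult_monomial:
  "(E, R) \<in> monomial_indices \<Longrightarrow> j \<notin> E \<Longrightarrow>
    taus M j * monomial M (E, R) = monomial M (insert j E, R)"
  by (simp add: monomial_def monomial_indices_def)

lemma xis_mult_monomial:
  assumes "(E, R) \<in> monomial_indices"
  shows "xis M j * monomial M (E, R) = monomial M (E, R(j := Suc (R j)))"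
proof -
  let ?S = "insert j {i. R i \<noteq> 0}"
  have fin: "finite ?S"
    using assms by (simp add: monomial_indices_def)
  have "(\<Prod>i\<in>?S - {j}. xis M i ^ (R(j := Suc (R j))) i) = (\<Prod>i\<in>?S - {j}. xis M i ^ R i)"
    by (rule prod.cong) auto
  then have *: "(\<Prod>i\<in>?S. xis M i ^ (R(j := Suc (R j))) i) = xis M j * (\<Prod>i\<in>?S. xis M i ^ R i)"
    unfolding prod.remove[OF fin insertI1] by (simp only: fun_upd_same power_Suc mult.assoc)
  have "{i. (R(j := Suc (R j))) i \<noteq> 0} \<subseteq> ?S"
    by auto
  from monomial_eq[OF fin this, of E] monomial_eq[OF fin subset_insertI, of E] show ?thesis
    by (simp only: * mult.left_commute)
qed

lemma indices_insert: "(E, R) \<in> monomial_indices \<Longrightarrow> (insert j E, R) \<in> monomial_indices"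
  by (simp add: monomial_indices_def)

lemma indices_subset: "(E, R) \<in> monomial_indices \<Longrightarrow> F \<subseteq> E \<Longrightarrow> (F, R) \<in> monomial_indices"
  by (auto simp: monomial_indices_def intro: finite_subset)

lemma indices_update:
  assumes "(E, R) \<in> monomial_indices" "j \<ge> 1"
  shows "(E, R(j := r)) \<in> monomial_indices"
proof -
  have "{i. (R(j := r)) i \<noteq> 0} \<subseteq> insert j {i. R i \<noteq> 0}"
    by auto
  then have "finite {i. (R(j := r)) i \<noteq> 0}"
    by (rule finite_subset) (use assms in \<open>simp add: monomial_indices_def\<close>)
  then show ?thesis
    using assms by (simp add: monomial_indices_def)
qed

lemma indices_zero: "finite E \<Longrightarrow> (E, \<lambda>_. 0) \<in> monomial_indices"
  by (simp add: monomial_indices_def)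

lemma monomial_xis_1: "monomial M (E, (\<lambda>_. 0)(1 := r)) = prod (taus M) E * xis M 1 ^ r"
proof -
  have "{i. ((\<lambda>_. 0)(1 := r)) i \<noteq> (0::nat)} \<subseteq> {1}"
    by auto
  from monomial_eq[OF _ this, of E] show ?thesis
    by (simp add: fun_upd_def)
qed

lemma xis_1_power: "xis M 1 ^ r = monomial M ({}, (\<lambda>_. 0)(1 := r))"
  by (simp only: monomial_xis_1 prod.empty mult_1_left)

lemma Sq_power_two: "Sq M (2 ^ (k + 1)) = dual_elem M (monomial M ({}, (\<lambda>_. 0)(1 := 2 ^ k)))"
  unfolding xis_1_power[symmetric] using Sq_even[of "2 ^ k"] by simp

lemma monomial_in [simp]: "m \<in> monomial_indices \<Longrightarrow> monomial M m \<in> monomials M"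
  by (simp add: monomials_def)

text \<open>Compares two descriptions of \<open>Sq M 0\<close>: the unit, and the dual of
  \<open>\<xi>\<^sub>1 ^ 0\<close>.\<close>

lemma dual_one: "dual_elem M 1 = 1"
  using Sq_even[of 0] Sq_0 by simp

subsection \<open>Contraction of the second tensor factor\<close>

definition contract_list :: "'a \<Rightarrow> ('d \<times> 'd) list \<Rightarrow> 'd" where
  "contract_list \<theta> xs = (\<Sum>(a, b)\<leftarrow>xs. a * etaR M (pairing M b \<theta>))"

text \<open>Elements of the tensor square are accessible only through formal sums, so a representing
  list is chosen; \<open>contract_tensor_sum\<close> shows that the choice does not matter.\<close>

definition contract :: "'a \<Rightarrow> 't \<Rightarrow> 'd" where
  "contract \<theta> t = contract_list \<theta> (SOME xs. t = tensor_sum (tensL M) (tensR M) xs)"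

text \<open>The balancing relation is respected because the pairing is left linear: a factor
  \<open>etaL M h\<close> in the second entry comes out as \<open>etaR M h\<close>, which multiplies
  the first.\<close>

lemma contract_list_cong:
  "tensor_eq (etaR M) (etaL M) xs ys \<Longrightarrow> contract_list \<theta> xs = contract_list \<theta> ys"
proof (induction rule: tensor_eq.induct)
  case (balanced a h b)
  show ?case by (simp add: contract_list_def pairing_etaL mult.assoc)
qed (simp_all add: contract_list_def pairing_add_left algebra_simps)

lemma tensor_sum_exists: "\<exists>xs. t = tensor_sum (tensL M) (tensR M) xs"
  using tensor unfolding is_tensor_product_def by blast

lemma tensor_sum_eq_iff:
  "tensor_sum (tensL M) (tensR M) xs = tensor_sum (tensL M) (tensR M) ys
    \<longleftrightarrow> tensor_eq (etaR M) (etaL M) xs ys"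
  using tensor unfolding is_tensor_product_def by blast

lemma contract_tensor_sum:
  "contract \<theta> (tensor_sum (tensL M) (tensR M) xs) = contract_list \<theta> xs"
proof -
  define ys where
    "ys = (SOME ys. tensor_sum (tensL M) (tensR M) xs = tensor_sum (tensL M) (tensR M) ys)"
  have "tensor_sum (tensL M) (tensR M) xs = tensor_sum (tensL M) (tensR M) ys"
    unfolding ys_def by (rule someI[of _ xs]) simp
  then have "tensor_eq (etaR M) (etaL M) xs ys"
    by (rule tensor_sum_eq_iff[THEN iffD1])
  from contract_list_cong[OF this, of \<theta>] show ?thesis
    unfolding contract_def ys_def[symmetric] by simp
qed

lemma contract_tensor: "contract \<theta> (tensL M a * tensR M b) = a * etaR M (pairing M b \<theta>)"
  using contract_tensor_sum[of \<theta> "[(a, b)]"] by (simp add: tensor_sum_def contract_list_def)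

lemma contract_zero [simp]: "contract \<theta> 0 = 0"
  using contract_tensor[of \<theta> 0 0] by simp

lemma contract_add: "contract \<theta> (s + t) = contract \<theta> s + contract \<theta> t"
proof -
  obtain xs ys where "s = tensor_sum (tensL M) (tensR M) xs" "t = tensor_sum (tensL M) (tensR M) ys"
    using tensor_sum_exists by blast
  moreover have "s + t = tensor_sum (tensL M) (tensR M) (xs @ ys)"
    using calculation by (simp add: tensor_sum_def)
  ultimately show ?thesis
    by (simp only: contract_tensor_sum) (simp add: contract_list_def)
qed

lemma contract_diff: "contract \<theta> (s - t) = contract \<theta> s - contract \<theta> t"
  using contract_add[of \<theta> "s - t" t] by simp

lemma contract_sum: "contract \<theta> (sum f A) = (\<Sum>i\<in>A. contract \<theta> (f i))"
  by (induction A rule: infinite_finite_induct) (simp_all add: contract_add)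

lemma tensor_induct [case_names add tensor]:
  assumes add: "\<And>s t. P s \<Longrightarrow> P t \<Longrightarrow> P (s + t)"
    and tensor: "\<And>a b. P (tensL M a * tensR M b)"
  shows "P t"
proof -
  obtain xs where xs: "t = tensor_sum (tensL M) (tensR M) xs"
    using tensor_sum_exists by blast
  have "P (tensor_sum (tensL M) (tensR M) xs)"
    using tensor[of 0 0] by (induction xs) (auto simp: tensor_sum_def intro!: add tensor)
  with xs show ?thesis by simp
qed

lemma contract_tensL: "contract \<theta> (tensL M a * t) = a * contract \<theta> t"
proof (induction t rule: tensor_induct)
  case (add s t)
  then show ?case by (simp add: contract_add distrib_left)
next
  case (tensor a' b)
  show ?case
    using contract_tensor[of \<theta> "a * a'" b] by (simp add: contract_tensor mult.assoc)
qed

text \<open>Scalars cross the tensor sign. This turns a coefficient \<open>tau\<close> of a relation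
  in the second factor into \<open>etaR M (tau M)\<close> in the first.\<close>

lemma tensR_etaL: "tensR M (etaL M h) = tensL M (etaR M h)"
proof -
  have "tensor_eq (etaR M) (etaL M) [(1 * etaR M h, 1)] [(1, etaL M h * 1)]"
    by (rule tensor_eq.balanced)
  then have "tensor_sum (tensL M) (tensR M) [(etaR M h, 1)]
      = tensor_sum (tensL M) (tensR M) [(1, etaL M h)]"
    by (simp add: tensor_sum_eq_iff)
  then show ?thesis
    by (simp add: tensor_sum_def)
qed

lemma contract_tensR_etaL: "contract \<theta> (tensR M (etaL M h) * t) = etaR M h * contract \<theta> t"
  by (simp add: tensR_etaL contract_tensL)

text \<open>Pairing with 1 is the counit, which is multiplicative.\<close>

lemma contract_one_tensR: "contract 1 (tensR M b * t) = etaR M (counit M b) * contract 1 t"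
proof (induction t rule: tensor_induct)
  case (add s t)
  then show ?case by (simp add: contract_add distrib_left)
next
  case (tensor a b')
  have "tensR M b * (tensL M a * tensR M b') = tensL M a * tensR M (b * b')"
    by (simp add: mult_ac)
  then show ?case
    by (simp only: contract_tensor) (simp add: pairing_one mult.left_commute)
qed

lemma contract_one_1 [simp]: "contract 1 1 = 1"
  using contract_tensor[of 1 1 1] by (simp add: pairing_one)

text \<open>Duality of product and coproduct: by \<open>pairing_etaR\<close>, the right unit in the
  contraction becomes right multiplication of \<open>\<theta>\<^sub>1\<close> by a scalar.\<close>

lemma pairing_mult_contract: "pairing M \<alpha> (\<theta>\<^sub>1 * \<theta>\<^sub>2) = pairing M (contract \<theta>\<^sub>2 (Delta M \<alpha>)) \<theta>\<^sub>1"
proof -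
  obtain xs where xs: "Delta M \<alpha> = tensor_sum (tensL M) (tensR M) xs"
    using tensor_sum_exists by blast
  have "pairing M (contract_list \<theta>\<^sub>2 xs) \<theta>\<^sub>1
      = (\<Sum>(\<alpha>\<^sub>1, \<alpha>\<^sub>2)\<leftarrow>xs. pairing M \<alpha>\<^sub>1 (\<theta>\<^sub>1 * scalar M (pairing M \<alpha>\<^sub>2 \<theta>\<^sub>2)))"
    by (induction xs) (auto simp: contract_list_def pairing_add_left pairing_etaR)
  then show ?thesis
    using pairing_mult[OF xs] contract_tensor_sum[of \<theta>\<^sub>2 xs] xs by simp
qed

text \<open>Contraction is linear over the first factor. Hence generators of that factor whose
  multiples all pair to zero with \<open>\<theta>\<^sub>1\<close> may be set to zero in the
  coproduct.\<close>

lemma pairing_contract_cong: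
  assumes "\<And>x y. x \<in> X \<Longrightarrow> pairing M (x * y) \<theta>\<^sub>1 = 0"
    and "cong_ideal (tensL M ` X) s t"
  shows "pairing M (contract \<theta>\<^sub>2 s) \<theta>\<^sub>1 = pairing M (contract \<theta>\<^sub>2 t) \<theta>\<^sub>1"
proof -
  have "s - t \<in> ideal.span (tensL M ` X)"
    using assms(2) by (simp add: cong_ideal_def)
  then have "pairing M (contract \<theta>\<^sub>2 (s - t)) \<theta>\<^sub>1 = 0"
  proof (induction rule: ideal.span_induct_alt)
    case (step c x y)
    then obtain z where "z \<in> X" "x = tensL M z" by blast
    moreover have "contract \<theta>\<^sub>2 (c * tensL M z) = z * contract \<theta>\<^sub>2 c"
      by (simp add: mult.commute[of c] contract_tensL)
    ultimately show ?case
      using step.IH assms(1) by (simp add: contract_add pairing_add_left)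
  qed simp
  then show ?thesis
    by (simp add: contract_diff pairing_diff_left)
qed

end

text \<open>If \<open>1 = 0\<close> in the cohomology of the base, all monomials coincide and coefficients are meaningless.\<close>

locale nontrivial_motivic_steenrod = motivic_steenrod M
  for M :: "('h::comm_ring_1, 'd::comm_ring_1, 't::comm_ring_1, 'a::ring_1) steenrod_data" +
  assumes nontrivial: "(1::'h) \<noteq> 0"
begin

text \<open>Uniqueness of coefficients, applied to two indicator functions that represent the same
  element; \<open>1 \<noteq> 0\<close> makes their supports singletons.\<close>

lemma monomial_inject:
  assumes "m \<in> monomial_indices" "m' \<in> monomial_indices"
  shows "monomial M m = monomial M m' \<longleftrightarrow> m = m'"
proof
  assume eq: "monomial M m = monomial M m'"
  let ?c = "\<lambda>m k. if k = m then 1 else (0::'h)"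
  have supp: "{k. ?c m k \<noteq> 0} = {m}" for m
    using nontrivial by auto
  have unique: "\<exists>!c. P c \<Longrightarrow> P c \<Longrightarrow> P c' \<Longrightarrow> c = c'" for P and c c' :: "nat set \<times> (nat \<Rightarrow> nat) \<Rightarrow> 'h"
    by blast
  have "?c m = ?c m'"
    by (rule unique[OF free[of "monomial M m"]]; unfold supp) (simp_all add: assms eq[symmetric])
  from fun_cong[OF this, of m] show "m = m'"
    using nontrivial by (simp split: if_splits)
qed simp

abbreviation coef :: "nat set \<Rightarrow> (nat \<Rightarrow> nat) \<Rightarrow> 'd \<Rightarrow> 'h" where
  "coef E R \<alpha> \<equiv> pairing M \<alpha> (dual_elem M (monomial M (E, R)))"

lemma coef_monomial:
  assumes "(E, R) \<in> monomial_indices" "(E', R') \<in> monomial_indices"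
  shows "coef E R (monomial M (E', R')) = (if E' = E \<and> R' = R then 1 else 0)"
  using pairing_dual_elem[of "monomial M (E, R)" "monomial M (E', R')"] assms
    monomial_inject[OF assms(2) assms(1)] by auto

text \<open>Multiplication by \<open>\<xi>\<^sub>j\<close> sends monomials injectively to monomials,
  so it only shifts one exponent.\<close>

lemma coef_xis:
  assumes "(E, R) \<in> monomial_indices" "j \<ge> 1"
  shows "coef E R (xis M j * \<alpha>) = (if R j = 0 then 0 else coef E (R(j := R j - 1)) \<alpha>)"
proof (induction \<alpha> rule: dual_induct)
  case (add \<alpha> \<beta>)
  then show ?case
    unfolding distrib_left pairing_add_left
    by (cases "R j = 0") (simp_all only: if_True if_False add_0 simp_thms)
next
  case (monomial c E' R')
  have "coef E R (xis M j * monomial M (E', R'))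
      = (if R j = 0 then 0 else coef E (R(j := R j - 1)) (monomial M (E', R')))"
  proof -
    have "R'(j := Suc (R' j)) = R \<longleftrightarrow> R j \<noteq> 0 \<and> R' = R(j := R j - 1)"
      by auto
    then show ?thesis
      using monomial assms
      by (simp add: xis_mult_monomial coef_monomial indices_update del: fun_upd_apply)
  qed
  then show ?case
    by (simp add: pairing_etaL mult.left_commute del: fun_upd_apply)
qed

lemma coef_one: "coef {} (\<lambda>_. 0) \<alpha> = counit M \<alpha>"
  by (simp add: dual_one pairing_one)

lemma indices_single [simp]: "finite E \<Longrightarrow> j \<ge> 1 \<Longrightarrow> (E, (\<lambda>_. 0)(j := r)) \<in> monomial_indices"
  by (intro indices_update indices_zero)

lemma xis_eq_monomial: "xis M j = monomial M ({}, (\<lambda>_. 0)(j := 1))"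
  using xis_mult_monomial[OF indices_zero[of "{}"], of j] by simp

lemma taus_eq_monomial: "taus M j = monomial M ({j}, \<lambda>_. 0)"
  by (simp add: monomial_no_xi)

subsection \<open>Multiplication by the primitives \<open>Q\<^sub>k\<close>\<close>

lemma Delta_monomial:
  "Delta M (monomial M (E, R))
    = (\<Prod>i\<in>E. Delta M (taus M i)) * (\<Prod>i | R i \<noteq> 0. Delta M (xis M i) ^ R i)"
  by (simp add: monomial_def unital_ring_homD[OF Delta_hom] unital_ring_hom_prod[OF Delta_hom]
      unital_ring_hom_power[OF Delta_hom])

lemma cong_tensL_power:
  assumes "x \<in> X" "k \<ge> 1"
  shows "cong_ideal (tensL M ` X) (tensL M (x ^ k) * t) 0"
proof -
  obtain l where "k = Suc l"
    using assms(2) by (cases k) auto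
  then have "tensL M (x ^ k) * t = tensL M (x ^ l) * t * tensL M x"
    by (simp add: mult_ac)
  then show ?thesis
    using assms(1) by (simp add: cong_ideal_zero)
qed

text \<open>Only the summand \<open>i = k\<close>, whose first factor is a power of
  \<open>\<xi>\<^sub>0 = 1\<close>, avoids the ideal. The family \<open>f\<close> covers both
  \<open>Delta_xis\<close> and \<open>Delta_taus\<close>.\<close>

lemma cong_coproduct_sum:
  assumes "xis M ` {1..} \<subseteq> X"
  shows "cong_ideal (tensL M ` X)
    (\<Sum>i\<le>k. tensL M (xis M (k - i) ^ 2 ^ i) * tensR M (f i)) (tensR M (f k))"
proof -
  have "cong_ideal (tensL M ` X)
      (\<Sum>i<k. tensL M (xis M (k - i) ^ 2 ^ i) * tensR M (f i)) (\<Sum>i<k. 0)"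
    by (intro cong_ideal_sum cong_tensL_power) (use assms in auto)
  from cong_ideal_add[OF this cong_ideal_refl[of _ "tensR M (f k)"]] show ?thesis
    by (simp add: xis_0 flip: lessThan_Suc_atMost)
qed

text \<open>Modulo the \<open>\<xi>\<^sub>j \<otimes> 1\<close> the coproduct is primitive on each \<open>\<tau>\<^sub>i\<close>, so that no relation is needed
  to expand it on a monomial.\<close>

lemma milnor_Q_mult_dual:
  assumes "(E, R) \<in> monomial_indices"
  shows "milnor_Q M k * dual_elem M (monomial M (E, R))
    = (if k \<in> E then 0 else dual_elem M (monomial M (insert k E, R)))"
proof (rule steenrod_eqI)
  fix m assume "m \<in> monomial_indices"
  then obtain E' R' where m: "m = (E', R')" "(E', R') \<in> monomial_indices"
    by (cases m) auto
  then have fin: "finite E'"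
    by (simp add: monomial_indices_def)
  let ?D = "dual_elem M (monomial M (E, R))" and ?X = "xis M ` {1..}"
  let ?xi = "\<Prod>i | R' i \<noteq> 0. xis M i ^ R' i"
  have "cong_ideal (tensL M ` ?X) (Delta M (monomial M (E', R')))
      ((\<Prod>i\<in>E'. tensL M (taus M i) + tensR M (taus M i)) * (\<Prod>i | R' i \<noteq> 0. tensR M (xis M i) ^ R' i))"
    unfolding Delta_monomial Delta_taus Delta_xis
    by (intro cong_ideal_mult cong_ideal_prod cong_ideal_power cong_ideal_add cong_ideal_refl
        cong_coproduct_sum order_refl)
  \<comment> \<open>The subset \<open>F\<close> records which \<tau>-factors go to the first tensor
    factor.\<close>
  also have "(\<Prod>i\<in>E'. tensL M (taus M i) + tensR M (taus M i)) * (\<Prod>i | R' i \<noteq> 0. tensR M (xis M i) ^ R' i)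
      = (\<Sum>F\<in>Pow E'. tensL M (prod (taus M) F) * tensR M (monomial M (E' - F, R')))"
    by (simp add: prod_add[OF fin] sum_distrib_right monomial_def unital_ring_hom_prod[OF tensL_hom]
        unital_ring_hom_prod[OF tensR_hom] mult.assoc)
  finally have cong: "cong_ideal (tensL M ` ?X) (Delta M (monomial M (E', R'))) \<dots>" .
  \<comment> \<open>Pairing the first factor with \<open>Q\<^sub>k\<close> selects
    \<open>F = {k}\<close>; the rest is compared with \<open>(E, R)\<close> in the second
    factor.\<close>
  have summand: "coef {k} (\<lambda>_. 0) (contract ?D (tensL M (prod (taus M) F) * tensR M (monomial M (E' - F, R'))))
      = (if F = {k} then if E' - {k} = E \<and> R' = R then 1 else 0 else 0)" if "F \<in> Pow E'" for F
  proof -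
    have "(E' - F, R') \<in> monomial_indices" "(F, \<lambda>_. 0) \<in> monomial_indices"
      using that fin indices_subset[OF m(2)] by (auto intro: indices_zero finite_subset)
    then show ?thesis
      using assms by (simp add: contract_tensor coef_monomial indices_zero flip: monomial_no_xi)
  qed
  have "pairing M (monomial M m) (milnor_Q M k * ?D)
      = coef {k} (\<lambda>_. 0) (contract ?D (\<Sum>F\<in>Pow E'. tensL M (prod (taus M) F) * tensR M (monomial M (E' - F, R'))))"
    unfolding m pairing_mult_contract milnor_Q_def taus_eq_monomial[of k]
    by (rule pairing_contract_cong[OF _ cong]) (auto simp: coef_xis indices_zero)
  also have "\<dots> = (\<Sum>F\<in>Pow E'. if F = {k} then if E' - {k} = E \<and> R' = R then 1 else 0 else 0)"
    unfolding contract_sum pairing_sum_left by (rule sum.cong[OF HOL.refl summand])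
  also have "\<dots> = (if k \<in> E' \<and> E' - {k} = E \<and> R' = R then 1 else 0)"
    using fin by simp
  \<comment> \<open>For \<open>k \<in> E\<close> no set satisfies \<open>E' - {k} = E\<close>, which
    gives the value zero.\<close>
  also have "\<dots> = pairing M (monomial M m) (if k \<in> E then 0 else dual_elem M (monomial M (insert k E, R)))"
    using assms m by (auto simp: coef_monomial indices_insert)
  finally show "pairing M (monomial M m) (milnor_Q M k * ?D)
      = pairing M (monomial M m) (if k \<in> E then 0 else dual_elem M (monomial M (insert k E, R)))" .
qed

lemma prod_list_milnor_Q_mult_dual:
  assumes "(E, R) \<in> monomial_indices" "distinct ks"
  shows "prod_list (map (milnor_Q M) ks) * dual_elem M (monomial M (E, R))
    = (if set ks \<inter> E = {} then dual_elem M (monomial M (set ks \<union> E, R)) else 0)"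
  using assms(2)
proof (induction ks)
  case (Cons k ks)
  have "(set ks \<union> E, R) \<in> monomial_indices"
    using assms(1) by (simp add: monomial_indices_def)
  then show ?case
    using Cons by (auto simp: mult.assoc milnor_Q_mult_dual)
qed simp

subsection \<open>The coefficient of a power of \<open>\<xi>\<^sub>1\<close>\<close>

abbreviation xi1_coef :: "nat \<Rightarrow> 'd \<Rightarrow> 'h" where
  "xi1_coef s \<equiv> coef {} ((\<lambda>_. 0)(1 := s))"

text \<open>All generators except \<open>\<xi>\<^sub>1\<close> and \<open>\<tau>\<^sub>0\<close>.
  The latter is left out because \<open>\<tau>\<^sub>0 ^ 2\<close> contains
  \<open>\<tau> \<xi>\<^sub>1\<close>, so its multiples may involve powers of
  \<open>\<xi>\<^sub>1\<close>.\<close>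

abbreviation other_generators :: "'d set" where
  "other_generators \<equiv> xis M ` {2..} \<union> taus M ` {1..}"

lemma xi1_coef_xis: "j \<ge> 2 \<Longrightarrow> xi1_coef s (xis M j * \<alpha>) = 0"
  by (simp add: coef_xis del: One_nat_def)

lemma xi1_coef_xi1_power:
  "xi1_coef s (xis M 1 ^ k * \<alpha>) = (if k \<le> s then xi1_coef (s - k) \<alpha> else 0)"
proof (induction k arbitrary: s)
  case (Suc k)
  have "xi1_coef s (xis M 1 * (xis M 1 ^ k * \<alpha>))
      = (if s = 0 then 0 else xi1_coef (s - 1) (xis M 1 ^ k * \<alpha>))"
    using coef_xis[of "{}" "(\<lambda>_. 0)(1 := s)" 1] by simp
  also have "\<dots> = (if Suc k \<le> s then xi1_coef (s - Suc k) \<alpha> else 0)"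
    unfolding Suc.IH by (cases s) simp_all
  finally show ?case
    by (simp only: power_Suc mult.assoc)
qed simp

text \<open>If \<open>\<tau>\<^sub>j\<close> is new, the product is a monomial containing it.
  Otherwise the relation for \<open>\<tau>\<^sub>j ^ 2\<close> yields multiples of
  \<open>\<xi>\<^sub>j\<^sub>+\<^sub>1\<close>, which do not count as \<open>j + 1 \<ge> 2\<close>,
  and \<open>\<tau>\<^sub>j\<^sub>+\<^sub>1\<close> times a monomial with fewer \<tau>-factors. The
  induction is thus on \<open>card E\<close>, with \<open>j\<close> free to grow.\<close>

lemma xi1_coef_taus:
  assumes "j \<ge> 1"
  shows "xi1_coef s (taus M j * \<alpha>) = 0"
proof (induction \<alpha> rule: dual_induct)
  case (add \<alpha> \<beta>)
  then show ?case by (simp add: distrib_left pairing_add_left)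
next
  case (monomial c E R)
  have "xi1_coef s (taus M j * monomial M (E, R)) = 0"
    using monomial assms
  proof (induction "card E" arbitrary: E j)
    case 0
    then have "E = {}"
      by (simp add: monomial_indices_def)
    then show ?case
      using 0 by (simp add: taus_mult_monomial coef_monomial indices_insert del: fun_upd_apply)
  next
    case (Suc d)
    show ?case
    proof (cases "j \<in> E")
      case True
      let ?m = "monomial M (E - {j}, R)"
      have idx: "(E - {j}, R) \<in> monomial_indices"
        using Suc.prems by (auto intro: indices_subset)
      have "insert j (E - {j}) = E"
        using True by blast
      then have "taus M j * monomial M (E, R) = taus M j * taus M j * ?m"
        using taus_mult_monomial[OF idx, of j] by (simp add: mult.assoc)
      also have "\<dots> = etaL M (tau M) * (xis M (Suc j) * ?m) + etaL M (rho M) * (taus M (Suc j) * ?m)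
          + etaL M (rho M) * (xis M (Suc j) * (taus M 0 * ?m))"
        unfolding taus_square by (simp add: distrib_left distrib_right mult_ac)
      moreover have "d = card (E - {j})"
        using Suc True by (simp add: monomial_indices_def)
      then have "xi1_coef s (taus M (Suc j) * ?m) = 0"
        by (rule Suc.hyps(1)) (use idx in auto)
      moreover have "xi1_coef s (xis M (Suc j) * \<beta>) = 0" for \<beta>
        using Suc.prems(2) by (intro xi1_coef_xis) simp
      ultimately show ?thesis
        by (simp add: pairing_add_left pairing_etaL)
    next
      case False
      then show ?thesis
        using Suc.prems by (simp add: taus_mult_monomial coef_monomial indices_insert del: fun_upd_apply)
    qed
  qed
  then show ?case
    by (simp only: mult.left_commute[of _ "etaL M c"] pairing_etaL mult_zero_right)
qed

lemma xi1_coef_other_generators: "x \<in> other_generators \<Longrightarrow> xi1_coef s (x * \<alpha>) = 0"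
proof -
  assume "x \<in> other_generators"
  then consider j where "j \<ge> 2" "x = xis M j" | j where "j \<ge> 1" "x = taus M j"
    by blast
  then show ?thesis
    by cases (simp_all only: xi1_coef_xis xi1_coef_taus)
qed

lemma xi1_coef_prod_taus: "finite E \<Longrightarrow> xi1_coef s (prod (taus M) E) = (if E = {} \<and> s = 0 then 1 else 0)"
proof -
  assume E: "finite E"
  have "(\<lambda>_. 0) = (\<lambda>_. 0)(1 := s) \<longleftrightarrow> s = 0"
    by (auto simp: fun_eq_iff)
  with coef_monomial[OF indices_single[of "{}" 1 s] indices_zero[OF E]] show ?thesis
    unfolding monomial_no_xi by (auto simp del: One_nat_def)
qed

lemma xi1_coef_one: "xi1_coef s 1 = (if s = 0 then 1 else 0)"
  using xi1_coef_prod_taus[of "{}" s] by simp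

lemma xi1_coef_tau0: "xi1_coef s (taus M 0) = 0"
  using xi1_coef_prod_taus[of "{0}" s] by simp

lemma xi1_coef_etaR_tau: "xi1_coef s (etaR M (tau M)) = (if s = 0 then tau M else 0)"
proof -
  have "etaR M (tau M) = etaL M (tau M) * 1 + etaL M (rho M) * taus M 0"
    by (simp add: etaR_tau)
  then show ?thesis
    by (simp only: pairing_add_left pairing_etaL xi1_coef_one xi1_coef_tau0) simp
qed

text \<open>The summand \<open>\<rho> \<tau>\<^sub>0\<close> of the right unit meets the other
  \<open>\<tau>\<^sub>0\<close>, and their square contributes \<open>\<tau> \<xi>\<^sub>1\<close>.
  This is the origin of the factor \<open>\<rho>\<close> and of the shifted exponent in the terms
  with an additional \<open>Q\<^sub>0\<close>.\<close>

lemma xi1_coef_tau0_etaR_tau: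
  "xi1_coef s (taus M 0 * etaR M (tau M)) = (if s = 1 then rho M * tau M else 0)"
proof -
  have "taus M 0 * etaR M (tau M)
      = etaL M (tau M) * taus M 0 + etaL M (rho M) * (taus M 0 * taus M 0)"
    by (simp add: etaR_tau distrib_left mult_ac)
  also have "taus M 0 * taus M 0 = etaL M (tau M) * (xis M 1 ^ 1 * 1)
      + etaL M (rho M) * (taus M 1 * 1) + etaL M (rho M) * (xis M 1 ^ 1 * taus M 0)"
    unfolding taus_square[of 0] by (simp add: mult_ac)
  finally show ?thesis
    by (simp only: pairing_add_left pairing_etaL xi1_coef_one xi1_coef_tau0 xi1_coef_taus
        xi1_coef_xi1_power order_refl) simp
qed

subsection \<open>Contraction with \<open>\<P>\<^sup>n\<close>\<close>

lemma pairing_milnor_P_xis: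
  assumes "n \<ge> 1" "j \<ge> 1"
  shows "pairing M (xis M j * \<alpha>) (milnor_P M n) = (if j = n then counit M \<alpha> else 0)"
proof -
  have "((\<lambda>_. 0)(n := 1))(n := (0::nat)) = (\<lambda>_. 0)"
    by auto
  then show ?thesis
    unfolding milnor_P_def xis_eq_monomial[of n]
    using assms coef_xis[of "{}" "(\<lambda>_. 0)(n := 1)" j \<alpha>] coef_one[of \<alpha>] by auto
qed

lemma pairing_milnor_P_taus:
  assumes "n \<ge> 1" "finite E"
  shows "pairing M (prod (taus M) E) (milnor_P M n) = 0"
proof -
  have "(\<lambda>_. 0) \<noteq> (\<lambda>_. 0)(n := (1::nat))"
    by (auto dest: fun_cong[of _ _ n])
  then show ?thesis
    unfolding milnor_P_def xis_eq_monomial[of n] monomial_no_xi[symmetric]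
    using assms by (simp add: coef_monomial indices_zero del: fun_upd_apply)
qed

text \<open>Once \<open>\<xi>\<^sub>n\<close> is used up in the second factor, the counit acts on
  the rest.\<close>

lemma contract_milnor_P_xis:
  assumes "n \<ge> 1" "j \<ge> 1"
  shows "contract (milnor_P M n) (tensR M (xis M j) * t) = (if j = n then contract 1 t else 0)"
proof (induction t rule: tensor_induct)
  case (add s t)
  then show ?case by (simp add: contract_add distrib_left)
next
  case (tensor a b)
  have "tensR M (xis M j) * (tensL M a * tensR M b) = tensL M a * tensR M (xis M j * b)"
    by (simp add: mult_ac)
  then show ?case
    by (simp only: contract_tensor pairing_milnor_P_xis[OF assms] pairing_one) simp
qed

text \<open>\<open>reduced_Delta i\<close> is \<open>\<Delta>(\<tau>\<^sub>i)\<close> for \<open>i \<ge> 1\<close> modulo \<open>x \<otimes> 1\<close> for \<open>x\<close> in \<open>other_generators\<close>.\<close>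

definition reduced_Delta :: "nat \<Rightarrow> 't" where
  "reduced_Delta i = tensR M (taus M i) + tensL M (xis M 1 ^ 2 ^ (i - 1)) * tensR M (taus M (i - 1))"

text \<open>A state of the expansion: \<open>F\<close> holds the \<tau>-factors already collected in
  the second tensor factor, \<open>E\<close> the indices of the factors still to be
  expanded.\<close>

definition contracted :: "nat \<Rightarrow> nat set \<Rightarrow> nat set \<Rightarrow> 'd" where
  "contracted n F E = contract (milnor_P M n) (tensR M (prod (taus M) F) * prod reduced_Delta E)"

text \<open>Both summands carry some \<open>\<tau>\<^sub>j\<close> in the second factor, where the
  counit kills it.\<close>

lemma contract_one_reduced_Delta: "contract 1 (reduced_Delta i * t) = 0"
  by (simp only: reduced_Delta_def distrib_right contract_add mult.assoc contract_tensL
      contract_one_tensR counit_taus) simp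

lemma contract_one_prod_reduced_Delta:
  assumes "finite F" "finite E"
  shows "contract 1 (tensR M (prod (taus M) F) * prod reduced_Delta E)
    = (if F = {} \<and> E = {} then 1 else 0)"
proof -
  have "counit M (prod (taus M) F) = (if F = {} then 1 else 0)"
    using assms(1) by (simp add: unital_ring_hom_prod[OF counit_hom] counit_taus power_0_left)
  moreover have "contract 1 (prod reduced_Delta E) = (if E = {} then 1 else 0)"
  proof (cases "E = {}")
    case False
    then obtain i where "i \<in> E" by blast
    then show ?thesis
      using False prod.remove[OF assms(2), of i reduced_Delta]
      by (simp add: contract_one_reduced_Delta)
  qed simp
  ultimately show ?thesis
    by (simp add: contract_one_tensR)
qed

text \<open>The carry rule: a repeated \<open>\<tau>\<^sub>b\<^sub>-\<^sub>1\<close> in the second factor becomes \<open>\<rho> \<tau>\<^sub>b\<close>, up to a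
  multiple of \<open>\<xi>\<^sub>b\<close>, which survives the contraction only if \<open>b = n\<close> and nothing else is left.\<close>

lemma contracted_insert:
  assumes "n \<ge> 1" "finite F" "finite E" "b \<ge> 1" "\<And>f. f \<in> F \<Longrightarrow> f < b" "\<And>e. e \<in> E \<Longrightarrow> b < e"
  shows "contracted n F (insert b E) = contracted n (insert b F) E
    + xis M 1 ^ 2 ^ (b - 1) *
      (if b - 1 \<in> F
       then (if b = n \<and> F = {b - 1} \<and> E = {} then etaR M (tau M) else 0)
         + etaL M (rho M) * contracted n (insert b (F - {b - 1})) E
       else contracted n (insert (b - 1) F) E)"
proof -
  define U where "U = prod reduced_Delta E"
  define F' where "F' = F - {b - 1}"
  let ?tau = "prod (taus M)" and ?C = "contract (milnor_P M n)"
  have notin: "b \<notin> F" "b \<notin> E" "b \<notin> F'"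
    using assms(5,6) by (auto simp: F'_def)
  \<comment> \<open>The factor at \<open>b\<close> is expanded into its two summands, which collect
    \<open>\<tau>\<^sub>b\<close> and \<open>\<tau>\<^sub>b\<^sub>-\<^sub>1\<close>
    respectively.\<close>
  have "tensR M (?tau F) * prod reduced_Delta (insert b E)
      = tensR M (?tau (insert b F)) * U
        + tensL M (xis M 1 ^ 2 ^ (b - 1)) * (tensR M (taus M (b - 1) * ?tau F) * U)"
    using notin assms(2,3) by (simp add: reduced_Delta_def U_def algebra_simps)
  then have split: "contracted n F (insert b E) = contracted n (insert b F) E
      + xis M 1 ^ 2 ^ (b - 1) * ?C (tensR M (taus M (b - 1) * ?tau F) * U)"
    by (simp only: contracted_def contract_add contract_tensL U_def)
  show ?thesis
  proof (cases "b - 1 \<in> F")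
    case False
    then show ?thesis
      using split assms(2) by (simp add: contracted_def U_def)
  next
    case True
    have F': "finite F'"
      using assms(2) by (simp add: F'_def)
    have "taus M (b - 1) * ?tau F = taus M (b - 1) * taus M (b - 1) * ?tau F'"
      unfolding F'_def prod.remove[OF assms(2) True] by (simp add: mult.assoc)
    also have "\<dots> = etaL M (tau M) * (xis M b * ?tau F') + etaL M (rho M) * (taus M b * ?tau F')
        + etaL M (rho M) * (xis M b * (taus M 0 * ?tau F'))"
      unfolding taus_square using assms(4) by (simp add: distrib_left distrib_right mult_ac)
    finally have "?C (tensR M (taus M (b - 1) * ?tau F) * U)
        = etaR M (tau M) * ?C (tensR M (xis M b) * (tensR M (?tau F') * U))
          + etaR M (rho M) * ?C (tensR M (taus M b * ?tau F') * U)
          + etaR M (rho M) * ?C (tensR M (xis M b) * (tensR M (taus M 0) * (tensR M (?tau F') * U)))"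
      by (simp only: tensR_simps distrib_right contract_add mult.assoc contract_tensR_etaL)
    moreover have "?C (tensR M (taus M b * ?tau F') * U) = contracted n (insert b F') E"
      using notin F' by (simp add: contracted_def U_def)
    moreover have "?C (tensR M (xis M b) * (tensR M (?tau F') * U))
        = (if b = n \<and> F' = {} \<and> E = {} then 1 else 0)"
      using assms(1,3,4) F' by (simp add: contract_milnor_P_xis U_def contract_one_prod_reduced_Delta)
    \<comment> \<open>Even when \<open>\<xi>\<^sub>b\<close> is consumed, the remaining
      \<open>\<tau>\<^sub>0\<close> has counit zero.\<close>
    moreover have "?C (tensR M (xis M b) * (tensR M (taus M 0) * (tensR M (?tau F') * U))) = 0"
      using assms(1,4) by (simp add: contract_milnor_P_xis contract_one_tensR counit_taus)
    moreover have "F' = {} \<longleftrightarrow> F = {b - 1}"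
      using True by (auto simp: F'_def)
    ultimately show ?thesis
      using True split by (simp add: etaR_rho[OF rho_degree] F'_def)
  qed
qed

section \<open>Evaluation of the chains of carries\<close>

lemma contracted_empty_right: "n \<ge> 1 \<Longrightarrow> finite F \<Longrightarrow> contracted n F {} = 0"
  using contract_tensor[of "milnor_P M n" 1] by (simp add: contracted_def pairing_milnor_P_taus)

text \<open>No step of \<open>contracted_insert\<close> lowers the number of collected
  \<tau>-factors: a carry exchanges one for the next, and the other choices add one. The terminal
  term requires a singleton \<open>F\<close>, so it is never reached.\<close>

lemma contracted_two:
  assumes "n \<ge> 1" "finite E" "finite F" "card F \<ge> 2" "\<And>f e. f \<in> F \<Longrightarrow> e \<in> E \<Longrightarrow> f < e"
  shows "contracted n F E = 0"
  using assms(2-)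
proof (induction E arbitrary: F rule: finite_linorder_min_induct)
  case empty
  then show ?case by (simp add: contracted_empty_right[OF assms(1)])
next
  case (insert b E)
  have less: "f < b" if "f \<in> F" for f
    using insert.prems(3) that by simp
  have "b \<ge> 1"
    using insert.prems less by (cases "b = 0") (auto simp: card_le_Suc_iff numeral_2_eq_2)
  have zero: "contracted n G E = 0" if "finite G" "card G \<ge> 2" "\<And>g. g \<in> G \<Longrightarrow> g \<le> b" for G
    by (rule insert.IH) (use that insert.hyps in \<open>force+\<close>)
  have notin: "b \<notin> F"
    using less by blast
  have "contracted n (insert b F) E = 0"
    by (rule zero) (use insert.prems less notin in \<open>auto intro: less_imp_le\<close>)
  moreover have "contracted n (insert (b - 1) F) E = 0" if "b - 1 \<notin> F"
    by (rule zero) (use insert.prems less that in \<open>auto intro: less_imp_le\<close>)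
  moreover have "contracted n (insert b (F - {b - 1})) E = 0" if "b - 1 \<in> F"
    by (rule zero) (use insert.prems less that notin in \<open>auto intro: less_imp_le\<close>)
  moreover have "F \<noteq> {b - 1}"
    using insert.prems(2) by auto
  moreover have "contracted n F (insert b E) = contracted n (insert b F) E
    + xis M 1 ^ 2 ^ (b - 1) *
      (if b - 1 \<in> F
       then (if b = n \<and> F = {b - 1} \<and> E = {} then etaR M (tau M) else 0)
         + etaL M (rho M) * contracted n (insert b (F - {b - 1})) E
       else contracted n (insert (b - 1) F) E)"
    by (rule contracted_insert) (use assms(1) insert \<open>b \<ge> 1\<close> less in auto)
  ultimately show ?case by simp
qed

text \<open>A single \<open>\<tau>\<^sub>k\<close> survives only by carries at \<open>k + 1\<close>,
  \<open>k + 2\<close>, and so on up to \<open>n\<close>. They contribute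
  \<open>\<xi>\<^sub>1\<close> to the power
  \<open>2 ^ k + ... + 2 ^ (n - 1) = 2 ^ n - 2 ^ k\<close>; each but the last gives a factor
  \<open>\<rho>\<close>, and the last gives \<open>etaR M (tau M)\<close>.\<close>

lemma contracted_singleton:
  assumes "n \<ge> 1" "finite E" "\<And>e. e \<in> E \<Longrightarrow> k < e"
  shows "contracted n {k} E = (if k < n \<and> E = {Suc k..n}
    then xis M 1 ^ (2 ^ n - 2 ^ k) * (etaL M (rho M) ^ (n - 1 - k) * etaR M (tau M)) else 0)"
  using assms(2-)
proof (induction E arbitrary: k rule: finite_linorder_min_induct)
  case empty
  then show ?case by (auto simp: contracted_empty_right[OF assms(1)])
next
  case (insert b E)
  have "k < b"
    using insert.prems by simp
  then have b: "k < b" "b \<ge> 1" "b \<notin> E"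
    using insert.hyps by auto
  have rec: "contracted n {k} (insert b E) = contracted n {b, k} E
    + xis M 1 ^ 2 ^ (b - 1) *
      (if b - 1 \<in> {k}
       then (if b = n \<and> {k} = {b - 1} \<and> E = {} then etaR M (tau M) else 0)
         + etaL M (rho M) * contracted n (insert b ({k} - {b - 1})) E
       else contracted n {b - 1, k} E)"
    by (rule contracted_insert) (use assms(1) insert b in auto)
  have two: "contracted n {b, k} E = 0"
    by (rule contracted_two) (use assms(1) insert b in force)+
  show ?case
  proof (cases "b = Suc k")
    case False
    \<comment> \<open>Across a gap nothing is repeated, so two distinct \<tau>-factors are
      collected.\<close>
    have "contracted n {b - 1, k} E = 0"
      by (rule contracted_two) (use assms(1) insert b False in force)+
    moreover have "insert b E \<noteq> {Suc k..n}" if "k < n"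
    proof
      assume eq: "insert b E = {Suc k..n}"
      have "Suc k \<in> insert b E"
        unfolding eq using that by simp
      then show False
        using False b insert.hyps by auto
    qed
    ultimately show ?thesis
      using rec two False b by auto
  next
    case True
    have "contracted n {k} (insert b E) = xis M 1 ^ 2 ^ k *
        ((if b = n \<and> E = {} then etaR M (tau M) else 0) + etaL M (rho M) * contracted n {b} E)"
      using rec two True by simp
    also have "contracted n {b} E = (if b < n \<and> E = {Suc b..n}
        then xis M 1 ^ (2 ^ n - 2 ^ b) * (etaL M (rho M) ^ (n - 1 - b) * etaR M (tau M)) else 0)"
      by (rule insert.IH) (use insert.hyps in auto)
    finally have eq: "contracted n {k} (insert b E) = xis M 1 ^ 2 ^ k *
        ((if b = n \<and> E = {} then etaR M (tau M) else 0) + etaL M (rho M) * \<dots>)" .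
    consider "b < n" | "b = n" | "n < b" by linarith
    then show ?thesis
    proof cases
      case 1
      have "{Suc k..n} = insert b {Suc b..n}" "b \<notin> {Suc b..n}"
        using 1 True by auto
      then have iff: "insert b E = {Suc k..n} \<longleftrightarrow> E = {Suc b..n}"
        using b(3) by (simp add: insert_ident)
      have "(2::nat) ^ b \<le> 2 ^ n"
        using 1 by simp
      \<comment> \<open>The carry at \<open>b = k + 1\<close> accounts for the summand
        \<open>2 ^ k\<close> of the exponent and for one factor \<open>\<rho>\<close>.\<close>
      then have diff: "(2::nat) ^ n - 2 ^ k = 2 ^ k + (2 ^ n - 2 ^ b)" "n - 1 - k = Suc (n - 1 - b)"
        using 1 True by auto
      then show ?thesis
        unfolding eq iff diff power_add using 1 \<open>k < b\<close> by (simp add: mult_ac)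
    next
      case 2
      have "insert b E = {Suc k..n} \<longleftrightarrow> E = {}"
        using 2 True b(3) by auto
      moreover have "(2::nat) ^ n - 2 ^ k = 2 ^ k"
        using 2 True by auto
      ultimately show ?thesis
        using 2 True eq by simp
    next
      case 3
      then show ?thesis
        using True eq by auto
    qed
  qed
qed

text \<open>The least index \<open>b\<close> of \<open>E\<close> must itself start the chain,
  through \<open>1 \<otimes> \<tau>\<^sub>b\<close>. At most one summand is nonzero, the one with
  \<open>e = b\<close>; the form as a sum matches the final formula.\<close>

lemma contracted_empty_left:
  assumes "n \<ge> 1" "finite E" "0 \<notin> E"
  shows "contracted n {} E = (\<Sum>e<n. if e \<ge> 1 \<and> E = {e..n}
    then xis M 1 ^ (2 ^ n - 2 ^ e) * (etaL M (rho M) ^ (n - 1 - e) * etaR M (tau M)) else 0)"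
proof (cases "E = {}")
  case True
  have "\<not> {e..n} = {}" if "e < n" for e
    using that by simp
  then show ?thesis
    using True by (auto simp: contracted_empty_right[OF assms(1)] intro!: sum.neutral)
next
  case False
  define b E' where "b = Min E" and "E' = E - {b}"
  have "b \<in> E"
    using False assms(2) by (simp add: b_def)
  then have E: "E = insert b E'" "b \<notin> E'" "finite E'" "b \<ge> 1"
    using assms(2,3) by (auto simp: E'_def Suc_le_eq intro: gr0I)
  have less: "b < e" if "e \<in> E'" for e
    using that assms(2) Min_le[of E e] by (auto simp: E'_def b_def order_less_le)
  have "contracted n {} E = contracted n {b} E' + xis M 1 ^ 2 ^ (b - 1) * contracted n {b - 1} E'"
    using contracted_insert[of n "{}" E' b] assms(1) E less by simp
  \<comment> \<open>A chain from \<open>b - 1\<close> would need the index \<open>b\<close>, which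
    has just been removed.\<close>
  moreover have "contracted n {b - 1} E' = 0"
  proof -
    have "b \<in> {b..n}" if "b - 1 < n"
      using that by simp
    then have no: "\<not> (b - 1 < n \<and> E' = {Suc (b - 1)..n})"
      using E(2,4) by auto
    moreover have "b - 1 < e" if "e \<in> E'" for e
      using less[OF that] by simp
    ultimately show ?thesis
      using contracted_singleton[OF assms(1) E(3), of "b - 1"] unfolding if_not_P[OF no] by simp
  qed
  moreover have "e \<ge> 1 \<and> E = {e..n} \<longleftrightarrow> e = b \<and> E' = {Suc b..n}" if "e < n" for e
  proof
    assume eq: "e \<ge> 1 \<and> E = {e..n}"
    moreover have "Min {e..n} = e"
      using that by (intro Min_eqI) auto
    ultimately have "e = b"
      by (simp add: b_def)
    with eq show "e = b \<and> E' = {Suc b..n}"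
      by (auto simp: E'_def)
  next
    assume "e = b \<and> E' = {Suc b..n}"
    with E that show "e \<ge> 1 \<and> E = {e..n}"
      by auto
  qed
  then have "(\<Sum>e<n. if e \<ge> 1 \<and> E = {e..n}
      then xis M 1 ^ (2 ^ n - 2 ^ e) * (etaL M (rho M) ^ (n - 1 - e) * etaR M (tau M)) else 0)
    = (\<Sum>e<n. if e = b then if E' = {Suc b..n}
        then xis M 1 ^ (2 ^ n - 2 ^ b) * (etaL M (rho M) ^ (n - 1 - b) * etaR M (tau M)) else 0 else 0)"
    by (intro sum.cong) auto
  ultimately show ?thesis
    using contracted_singleton[OF assms(1) E(3) less] by simp
qed

subsection \<open>The coefficients of the product\<close>

text \<open>The summands with \<open>i < k\<close> contain \<open>\<xi>\<^sub>j\<close> with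
  \<open>j \<ge> 2\<close> in the first factor; only the last two remain.\<close>

lemma cong_coproduct_sum_reduced:
  assumes "xis M ` {2..} \<subseteq> X"
  shows "cong_ideal (tensL M ` X)
    (\<Sum>i\<le>Suc k. tensL M (xis M (Suc k - i) ^ 2 ^ i) * tensR M (f i))
    (tensR M (f (Suc k)) + tensL M (xis M 1 ^ 2 ^ k) * tensR M (f k))"
proof -
  let ?g = "\<lambda>i. tensL M (xis M (Suc k - i) ^ 2 ^ i) * tensR M (f i)"
  have "cong_ideal (tensL M ` X) (\<Sum>i<k. ?g i) (\<Sum>i<k. 0)"
    by (intro cong_ideal_sum cong_tensL_power) (use assms in auto)
  from cong_ideal_add[OF this cong_ideal_refl[of _ "?g k + ?g (Suc k)"]]
  have "cong_ideal (tensL M ` X) (\<Sum>i\<le>Suc k. ?g i) (?g k + ?g (Suc k))"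
    by (simp add: add.assoc flip: lessThan_Suc_atMost)
  then show ?thesis
    by (simp add: xis_0 add.commute)
qed

lemma cong_Delta_taus:
  assumes "i \<ge> 1"
  shows "cong_ideal (tensL M ` other_generators) (Delta M (taus M i)) (reduced_Delta i)"
proof -
  obtain k where i: "i = Suc k"
    using assms by (cases i) auto
  have "cong_ideal (tensL M ` other_generators) (tensL M (taus M i ^ 1) * 1) 0"
    using assms by (intro cong_tensL_power) auto
  then have "cong_ideal (tensL M ` other_generators) (Delta M (taus M i))
      (0 + (tensR M (taus M (Suc k)) + tensL M (xis M 1 ^ 2 ^ k) * tensR M (taus M k)))"
    unfolding Delta_taus i by (intro cong_ideal_add cong_coproduct_sum_reduced) auto
  then show ?thesis
    by (simp add: reduced_Delta_def i)
qed

lemma Delta_taus_0: "Delta M (taus M 0) = tensL M (taus M 0) + tensR M (taus M 0)"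
  by (simp add: Delta_taus xis_0)

lemma Delta_xis_1: "Delta M (xis M 1) = tensL M (xis M 1) + tensR M (xis M 1)"
  by (simp add: Delta_xis xis_0 add.commute)

lemma Delta_mult: "Delta M (\<alpha> * \<beta>) = Delta M \<alpha> * Delta M \<beta>"
  by (simp add: unital_ring_homD[OF Delta_hom])

text \<open>One counit law of the coproduct, obtained from multiplying an operation by 1.\<close>

lemma pairing_contract_one_Delta: "pairing M (contract 1 (Delta M \<alpha>)) \<theta> = pairing M \<alpha> \<theta>"
  using pairing_mult_contract[of \<alpha> \<theta> 1] by simp

lemma counit_contract_one_Delta: "counit M (contract 1 (Delta M \<alpha>)) = counit M \<alpha>"
  using pairing_contract_one_Delta[of \<alpha> 1] by (simp add: pairing_one)

lemma xi1_coef_summand: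
  "xi1_coef s (xis M 1 ^ k * (etaL M (rho M) ^ l * etaR M (tau M)))
    = (if s = k then rho M ^ l * tau M else 0)"
  "xi1_coef s (taus M 0 * (xis M 1 ^ k * (etaL M (rho M) ^ l * etaR M (tau M))))
    = (if s = k + 1 then rho M ^ Suc l * tau M else 0)"
proof -
  have "xis M 1 ^ k * (etaL M (rho M) ^ l * etaR M (tau M))
      = etaL M (rho M ^ l) * (xis M 1 ^ k * etaR M (tau M))"
    by (simp add: mult_ac)
  then show "xi1_coef s (xis M 1 ^ k * (etaL M (rho M) ^ l * etaR M (tau M)))
      = (if s = k then rho M ^ l * tau M else 0)"
    by (simp only: pairing_etaL xi1_coef_xi1_power xi1_coef_etaR_tau) auto
  have "taus M 0 * (xis M 1 ^ k * (etaL M (rho M) ^ l * etaR M (tau M)))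
      = etaL M (rho M ^ l) * (xis M 1 ^ k * (taus M 0 * etaR M (tau M)))"
    by (simp add: mult_ac)
  then show "xi1_coef s (taus M 0 * (xis M 1 ^ k * (etaL M (rho M) ^ l * etaR M (tau M))))
      = (if s = k + 1 then rho M ^ Suc l * tau M else 0)"
    by (simp only: pairing_etaL xi1_coef_xi1_power xi1_coef_tau0_etaR_tau) (auto simp: mult_ac)
qed

text \<open>Chains with \<open>e \<ge> 1\<close> arise when \<open>0 \<notin> E\<close>. If
  \<open>0 \<in> E\<close>, the summand \<open>1 \<otimes> \<tau>\<^sub>0\<close> of
  \<open>\<Delta> \<tau>\<^sub>0\<close> starts the chain with \<open>e = 0\<close>, while
  \<open>\<tau>\<^sub>0 \<otimes> 1\<close> stays in front of a chain on the other indices and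
  yields the second sum.\<close>

lemma xi1_coef_contract_Delta_taus:
  assumes "n \<ge> 1" "finite E"
  shows "xi1_coef s (contract (milnor_P M n) (Delta M (prod (taus M) E)))
    = (\<Sum>e<n. if E = {e..n} \<and> s = 2 ^ n - 2 ^ e then rho M ^ (n - 1 - e) * tau M else 0)
    + (\<Sum>e<n. if e \<ge> 1 \<and> E = insert 0 {e..n} \<and> s = 2 ^ n - 2 ^ e + 1
        then rho M ^ (n - e) * tau M else 0)"
proof -
  let ?C = "contract (milnor_P M n)"
  have Delta: "Delta M (prod (taus M) F) = (\<Prod>i\<in>F. Delta M (taus M i))" for F
    by (simp add: unital_ring_hom_prod[OF Delta_hom])
  have reduce: "cong_ideal (tensL M ` other_generators) (\<Prod>i\<in>F. Delta M (taus M i)) (prod reduced_Delta F)"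
    if "0 \<notin> F" for F
    using that by (intro cong_ideal_prod cong_Delta_taus) (metis One_nat_def Suc_leI gr0I)
  have coef_cong: "xi1_coef s (?C t) = xi1_coef s (?C t')"
    if "cong_ideal (tensL M ` other_generators) t t'" for t t'
    by (rule pairing_contract_cong[OF xi1_coef_other_generators that])
  show ?thesis
  proof (cases "0 \<in> E")
    case False
    have "xi1_coef s (?C (Delta M (prod (taus M) E))) = xi1_coef s (contracted n {} E)"
      using coef_cong[OF reduce[OF False]] by (simp add: Delta contracted_def)
    also have "\<dots> = (\<Sum>e<n. if E = {e..n} \<and> s = 2 ^ n - 2 ^ e then rho M ^ (n - 1 - e) * tau M else 0)"
      unfolding contracted_empty_left[OF assms False] pairing_sum_left
    proof (rule sum.cong[OF HOL.refl])
      fix e assume "e \<in> {..<n}"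
      have "E = {e..n} \<Longrightarrow> e \<ge> 1"
        using False by (cases e) auto
      then show "xi1_coef s (if e \<ge> 1 \<and> E = {e..n}
            then xis M 1 ^ (2 ^ n - 2 ^ e) * (etaL M (rho M) ^ (n - 1 - e) * etaR M (tau M)) else 0)
          = (if E = {e..n} \<and> s = 2 ^ n - 2 ^ e then rho M ^ (n - 1 - e) * tau M else 0)"
        using xi1_coef_summand(1)[where s = s and k = "2 ^ n - 2 ^ e" and l = "n - 1 - e"] by auto
    qed
    also have "(\<Sum>e<n. if e \<ge> 1 \<and> E = insert 0 {e..n} \<and> s = 2 ^ n - 2 ^ e + 1
        then rho M ^ (n - e) * tau M else 0) = 0"
      using False by (intro sum.neutral) auto
    ultimately show ?thesis
      by simp
  next
    case True
    define E' where "E' = E - {0}"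
    have E': "E = insert 0 E'" "0 \<notin> E'" "finite E'"
      using True assms(2) by (auto simp: E'_def)
    have "cong_ideal (tensL M ` other_generators) (Delta M (prod (taus M) E))
        ((tensL M (taus M 0) + tensR M (taus M 0)) * prod reduced_Delta E')"
      unfolding Delta unfolding E'(1) prod.insert[OF E'(3,2)] Delta_taus_0
      by (intro cong_ideal_mult cong_ideal_refl reduce E'(2))
    from coef_cong[OF this] have "xi1_coef s (?C (Delta M (prod (taus M) E)))
        = xi1_coef s (taus M 0 * contracted n {} E') + xi1_coef s (contracted n {0} E')"
      by (simp add: distrib_right contract_add contract_tensL contracted_def pairing_add_left)
    moreover have "xi1_coef s (contracted n {0} E')
        = (\<Sum>e<n. if E = {e..n} \<and> s = 2 ^ n - 2 ^ e then rho M ^ (n - 1 - e) * tau M else 0)"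
    proof -
      have "E = {e..n} \<longleftrightarrow> e = 0 \<and> E' = {Suc 0..n}" for e
      proof
        assume eq: "E = {e..n}"
        then have "e = 0"
          using True by auto
        with eq show "e = 0 \<and> E' = {Suc 0..n}"
          by (auto simp: E'_def)
      next
        assume "e = 0 \<and> E' = {Suc 0..n}"
        with E'(1) show "E = {e..n}"
          by auto
      qed
      then have "(\<Sum>e<n. if E = {e..n} \<and> s = 2 ^ n - 2 ^ e then rho M ^ (n - 1 - e) * tau M else 0)
        = (\<Sum>e<n. if e = 0 then if E' = {Suc 0..n} \<and> s = 2 ^ n - 2 ^ 0
            then rho M ^ (n - 1 - 0) * tau M else 0 else 0)"
        by (intro sum.cong) auto
      also have "\<dots> = xi1_coef s (contracted n {0} E')"
      proof -
        have pos: "0 < e" if "e \<in> E'" for e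
          using that E'(2) by (cases e) auto
        show ?thesis
          using assms(1) contracted_singleton[OF assms(1) E'(3) pos]
            xi1_coef_summand(1)[where s = s and k = "2 ^ n - 2 ^ 0" and l = "n - 1 - 0"]
          by auto
      qed
      finally show ?thesis by simp
    qed
    moreover have "xi1_coef s (taus M 0 * contracted n {} E')
      = (\<Sum>e<n. if e \<ge> 1 \<and> E = insert 0 {e..n} \<and> s = 2 ^ n - 2 ^ e + 1
        then rho M ^ (n - e) * tau M else 0)"
      unfolding contracted_empty_left[OF assms(1) E'(3,2)] sum_distrib_left pairing_sum_left
    proof (rule sum.cong[OF HOL.refl])
      fix e assume "e \<in> {..<n}"
      then have "Suc (n - 1 - e) = n - e"
        by auto
      moreover have "E' = {e..n} \<longleftrightarrow> E = insert 0 {e..n}" if "e \<ge> 1"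
      proof -
        have "0 \<notin> {e..n}"
          using that by simp
        then show ?thesis
          using E'(2) unfolding E'(1) by (rule insert_ident[symmetric, rotated])
      qed
      ultimately show "xi1_coef s (taus M 0 * (if e \<ge> 1 \<and> E' = {e..n}
            then xis M 1 ^ (2 ^ n - 2 ^ e) * (etaL M (rho M) ^ (n - 1 - e) * etaR M (tau M)) else 0))
          = (if e \<ge> 1 \<and> E = insert 0 {e..n} \<and> s = 2 ^ n - 2 ^ e + 1
            then rho M ^ (n - e) * tau M else 0)"
        using xi1_coef_summand(2)[where s = s and k = "2 ^ n - 2 ^ e" and l = "n - 1 - e"] by auto
    qed
    ultimately show ?thesis
      by simp
  qed
qed

section \<open>Monomials with \<xi>-factors\<close>

text \<open>For \<open>n = 1\<close> the summand \<open>1 \<otimes> \<xi>\<^sub>1\<close> of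
  \<open>\<Delta> \<xi>\<^sub>1\<close> contributes as a derivation would; for larger
  \<open>n\<close> it contracts to zero. At \<open>r = 0\<close> the truncated exponent
  \<open>r - 1\<close> is multiplied by zero.\<close>

lemma contract_Delta_xi1_power:
  assumes "n \<ge> 1"
  shows "contract (milnor_P M n) (Delta M (xis M 1 ^ r * \<alpha>))
    = xis M 1 ^ r * contract (milnor_P M n) (Delta M \<alpha>)
    + (if n = 1 then etaL M (of_nat r) * (xis M 1 ^ (r - 1) * contract 1 (Delta M \<alpha>)) else 0)"
proof (induction r)
  case (Suc r)
  have one: "contract 1 (Delta M (xis M 1 ^ k * \<alpha>)) = xis M 1 ^ k * contract 1 (Delta M \<alpha>)" for k
  proof (induction k)
    case (Suc k)
    have "contract 1 (Delta M (xis M 1 * (xis M 1 ^ k * \<alpha>)))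
        = xis M 1 * contract 1 (Delta M (xis M 1 ^ k * \<alpha>))"
      unfolding Delta_mult[of "xis M 1"] Delta_xis_1 distrib_right contract_add contract_tensL
      by (simp only: contract_one_tensR counit_xis order_refl) simp
    with Suc.IH show ?case
      by (simp only: power_Suc mult.assoc)
  qed simp
  have "contract (milnor_P M n) (Delta M (xis M 1 * (xis M 1 ^ r * \<alpha>)))
      = xis M 1 * contract (milnor_P M n) (Delta M (xis M 1 ^ r * \<alpha>))
        + (if n = 1 then xis M 1 ^ r * contract 1 (Delta M \<alpha>) else 0)"
    unfolding Delta_mult[of "xis M 1"] Delta_xis_1 distrib_right contract_add contract_tensL
      contract_milnor_P_xis[OF assms order_refl] one by auto
  moreover have "xis M 1 * (etaL M (of_nat r) * (xis M 1 ^ (r - 1) * \<beta>)) + xis M 1 ^ r * \<beta>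
      = etaL M (of_nat (Suc r)) * (xis M 1 ^ r * \<beta>)" for \<beta>
  proof -
    have "xis M 1 * (etaL M (of_nat r) * (xis M 1 ^ (r - 1) * \<beta>)) = etaL M (of_nat r) * (xis M 1 ^ r * \<beta>)"
      by (cases r) (simp_all add: mult_ac del: of_nat_Suc)
    then show ?thesis
      by (simp add: distrib_right add.commute)
  qed
  ultimately show ?case
    unfolding Suc.IH power_Suc mult.assoc distrib_left by (simp add: add.assoc mult.assoc)
qed simp

text \<open>The factor \<open>\<xi>\<^sub>1 ^ r\<close> leaves the exponent \<open>2 ^ n - r\<close>
  to the chain. The last term is the case \<open>n = 1\<close> of
  \<open>\<xi>\<^sub>1 ^ 2 ^ n * \<xi>\<^sub>n\<close>, which is then the cube of
  \<open>\<xi>\<^sub>1\<close>.\<close>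

lemma product_coef_xi1_power:
  assumes "n \<ge> 1" "finite E"
  shows "xi1_coef (2 ^ n) (contract (milnor_P M n) (Delta M (xis M 1 ^ r * prod (taus M) E)))
    = (\<Sum>e<n. if E = {e..n} \<and> r = 2 ^ e then rho M ^ (n - 1 - e) * tau M else 0)
    + (\<Sum>e<n. if e \<ge> 1 \<and> E = insert 0 {e..n} \<and> r = 2 ^ e - 1 then rho M ^ (n - e) * tau M else 0)
    + (if n = 1 \<and> E = {} \<and> r = 3 then 1 else 0)"
proof -
  let ?C = "contract (milnor_P M n) (Delta M (prod (taus M) E))"
  have le: "(2::nat) ^ e \<le> 2 ^ n" if "e < n" for e
    using that by simp
  have "xi1_coef (2 ^ n) (xis M 1 ^ r * ?C)
      = (\<Sum>e<n. if E = {e..n} \<and> r = 2 ^ e then rho M ^ (n - 1 - e) * tau M else 0)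
      + (\<Sum>e<n. if e \<ge> 1 \<and> E = insert 0 {e..n} \<and> r = 2 ^ e - 1 then rho M ^ (n - e) * tau M else 0)"
  proof (cases "r \<le> 2 ^ n")
    case True
    have "2 ^ n - r = 2 ^ n - 2 ^ e \<longleftrightarrow> r = 2 ^ e" if "e < n" for e
      using True le[OF that] by arith
    moreover have "2 ^ n - r = 2 ^ n - 2 ^ e + 1 \<longleftrightarrow> r = 2 ^ e - 1" if "e < n" for e
    proof -
      have "(2::nat) ^ e \<ge> 1" by simp
      then show ?thesis
        using True le[OF that] by arith
    qed
    ultimately show ?thesis
      using True unfolding xi1_coef_xi1_power xi1_coef_contract_Delta_taus[OF assms]
      by (auto intro!: arg_cong2[of _ _ _ _ "(+)"] sum.cong)
  next
    case False
    have "r \<noteq> 2 ^ e \<and> r \<noteq> 2 ^ e - 1" if "e < n" for e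
      using False le[OF that] by arith
    then show ?thesis
      using False unfolding xi1_coef_xi1_power by (simp add: sum.neutral)
  qed
  moreover have "xi1_coef (2 ^ n) (etaL M (of_nat r) * (xis M 1 ^ (r - 1) * contract 1 (Delta M (prod (taus M) E))))
      = (if E = {} \<and> r = 3 then 1 else 0)" if "n = 1"
  proof -
    \<comment> \<open>The derivation produces the coefficient \<open>r = 3\<close>, which is 1 in
      characteristic two.\<close>
    have "(3::'h) = 1 + (1 + 1)"
      by simp
    then have "(3::'h) = 1"
      by (simp only: char_two add_0_right)
    moreover have "2 - (r - 1) = 0 \<and> r - 1 \<le> 2 \<longleftrightarrow> r = 3"
      by arith
    ultimately show ?thesis
      using that assms(2)
      unfolding pairing_etaL xi1_coef_xi1_power pairing_contract_one_Delta
      by (auto simp: xi1_coef_prod_taus xi1_coef_one simp del: One_nat_def)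
  qed
  ultimately show ?thesis
    unfolding contract_Delta_xi1_power[OF assms(1)] pairing_add_left by auto
qed

text \<open>Of \<open>1 \<otimes> \<xi>\<^sub>k\<close> and \<open>\<xi>\<^sub>1 ^ 2 ^ (k - 1)
  \<otimes> \<xi>\<^sub>k\<^sub>-\<^sub>1\<close>, contraction with \<open>\<P>\<^sup>n\<close>
  keeps the first for \<open>k = n\<close> and the second for \<open>k = n + 1\<close>. In the
  latter case the power of \<open>\<xi>\<^sub>1\<close> is exhausted and only the counit of
  \<open>\<alpha>\<close> is left.\<close>

lemma product_coef_xis:
  assumes "n \<ge> 1" "k \<ge> 2"
  shows "xi1_coef (2 ^ n) (contract (milnor_P M n) (Delta M (xis M k * \<alpha>)))
    = (if k = n then xi1_coef (2 ^ n) \<alpha> else 0) + (if k = n + 1 then counit M \<alpha> else 0)"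
proof -
  obtain l where k: "k = Suc l" "l \<ge> 1"
    using assms(2) by (cases k) auto
  have "cong_ideal (tensL M ` other_generators) (Delta M (xis M k * \<alpha>))
      ((tensR M (xis M k) + tensL M (xis M 1 ^ 2 ^ l) * tensR M (xis M l)) * Delta M \<alpha>)"
    unfolding Delta_mult unfolding Delta_xis k
    by (intro cong_ideal_mult cong_coproduct_sum_reduced cong_ideal_refl) auto
  from pairing_contract_cong[OF xi1_coef_other_generators this]
  have "xi1_coef (2 ^ n) (contract (milnor_P M n) (Delta M (xis M k * \<alpha>)))
      = xi1_coef (2 ^ n) (if k = n then contract 1 (Delta M \<alpha>) else 0)
      + xi1_coef (2 ^ n) (xis M 1 ^ 2 ^ l * (if l = n then contract 1 (Delta M \<alpha>) else 0))"
    using assms(1) k by (simp only: distrib_right contract_add mult.assoc contract_tensL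
        contract_milnor_P_xis pairing_add_left)
  moreover have "xi1_coef 0 \<beta> = counit M \<beta>" for \<beta>
  proof -
    have "(\<lambda>_. 0)(1 := 0) = (\<lambda>_::nat. 0::nat)"
      by auto
    then show ?thesis
      by (simp only: coef_one)
  qed
  ultimately show ?thesis
    using k by (simp add: xi1_coef_xi1_power pairing_contract_one_Delta counit_contract_one_Delta
        del: One_nat_def fun_upd_apply)
qed

text \<open>If some \<open>\<xi>\<^sub>k\<close> with \<open>k \<ge> 2\<close> occurs, one such
  factor is split off; otherwise only \<open>\<xi>\<^sub>1\<close> is present. The nested update
  encodes \<open>\<xi>\<^sub>1 ^ 2 ^ n * \<xi>\<^sub>n\<close> so that \<open>n = 1\<close> is
  included, where the two exponents add up.\<close>

lemma coef_milnor_expansion: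
  assumes "n \<ge> 1" "(E, R) \<in> monomial_indices"
  shows "pairing M (monomial M (E, R)) (Sq M (2 ^ (n + 1)) * milnor_P M n)
    = (if E = {} \<and> R = (\<lambda>_. 0)(n + 1 := 1) then 1 else 0)
    + (if E = {} \<and> R = ((\<lambda>_. 0)(1 := 2 ^ n))(n := Suc (((\<lambda>_. 0)(1 := 2 ^ n)) n)) then 1 else 0)
    + (\<Sum>e<n. if E = {e..n} \<and> R = (\<lambda>_. 0)(1 := 2 ^ e) then rho M ^ (n - 1 - e) * tau M else 0)
    + (\<Sum>e<n. if e \<ge> 1 \<and> E = insert 0 {e..n} \<and> R = (\<lambda>_. 0)(1 := 2 ^ e - 1)
        then rho M ^ (n - e) * tau M else 0)"
    (is "?lhs = (if ?A then 1 else 0) + (if ?B then 1 else 0) + ?S + ?T")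
proof -
  have lhs: "?lhs = xi1_coef (2 ^ n) (contract (milnor_P M n) (Delta M (monomial M (E, R))))"
    by (simp only: pairing_mult_contract Sq_power_two)
  have E: "finite E"
    using assms(2) by (simp add: monomial_indices_def)
  show ?thesis
  proof (cases "\<exists>k\<ge>2. R k \<noteq> 0")
    case True
    then obtain k where k: "k \<ge> 2" "R k \<noteq> 0"
      by blast
    define R' where "R' = R(k := R k - 1)"
    have R: "R = R'(k := Suc (R' k))" and idx: "(E, R') \<in> monomial_indices"
      using k assms(2) by (auto simp: R'_def intro!: indices_update)
    have "R \<noteq> (\<lambda>_. 0)(1 := r)" for r
      using k by auto
    then have "?S = 0" "?T = 0"
      by (simp_all add: sum.neutral del: fun_upd_apply)
    moreover have "?lhs = (if k = n then if E = {} \<and> R' = (\<lambda>_. 0)(1 := 2 ^ n) then 1 else 0 else 0)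
        + (if k = n + 1 then if E = {} \<and> R' = (\<lambda>_. 0) then 1 else 0 else 0)"
      unfolding lhs unfolding R xis_mult_monomial[OF idx, symmetric] product_coef_xis[OF assms(1) k(1)]
        coef_one[symmetric]
      using idx by (simp only: coef_monomial indices_single indices_zero finite.emptyI order_refl)
    moreover have "R = (\<lambda>_. 0)(n + 1 := 1) \<longleftrightarrow> k = n + 1 \<and> R' = (\<lambda>_. 0)"
      unfolding R using assms(1) by (auto simp: fun_eq_iff)
    moreover have "R = ((\<lambda>_. 0)(1 := 2 ^ n))(n := Suc (((\<lambda>_. 0)(1 := 2 ^ n)) n))
        \<longleftrightarrow> k = n \<and> R' = (\<lambda>_. 0)(1 := 2 ^ n)"
      unfolding R using k(1) by (auto simp: fun_eq_iff split: if_splits)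
    ultimately show ?thesis
      by auto
  next
    case False
    define r where "r = R 1"
    have "R 0 = 0"
      using assms(2) by (simp add: monomial_indices_def)
    have R: "R = (\<lambda>_. 0)(1 := r)"
    proof
      fix k :: nat
      consider "k = 0" | "k = 1" | "k \<ge> 2"
        by linarith
      then show "R k = ((\<lambda>_. 0)(1 := r)) k"
        using False \<open>R 0 = 0\<close> by cases (auto simp: r_def)
    qed
    have "xis M 1 ^ r * prod (taus M) E = monomial M (E, R)"
      unfolding R monomial_xis_1 by (rule mult.commute)
    then have "?lhs = (\<Sum>e<n. if E = {e..n} \<and> r = 2 ^ e then rho M ^ (n - 1 - e) * tau M else 0)
        + (\<Sum>e<n. if e \<ge> 1 \<and> E = insert 0 {e..n} \<and> r = 2 ^ e - 1 then rho M ^ (n - e) * tau M else 0)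
        + (if n = 1 \<and> E = {} \<and> r = 3 then 1 else 0)"
      unfolding lhs using product_coef_xi1_power[OF assms(1) E, of r] by simp
    moreover have "R = (\<lambda>_. 0)(1 := r') \<longleftrightarrow> r = r'" for r'
      unfolding R by (auto simp: fun_eq_iff)
    moreover have "\<not> ?A"
      unfolding R using assms(1) by (auto dest: fun_cong[of _ _ "n + 1"])
    moreover have "?B \<longleftrightarrow> n = 1 \<and> E = {} \<and> r = 3"
      unfolding R using assms(1) by (auto simp: fun_eq_iff split: if_splits)
    ultimately show ?thesis
      by (simp del: fun_upd_apply One_nat_def)
  qed
qed

end

section \<open>Assembly of the formula\<close>

theorem theorem6:
  fixes M :: "('h::comm_ring_1, 'd::comm_ring_1, 't::comm_ring_1, 'a::ring_1) steenrod_data"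
    and n :: nat
  assumes "motivic_steenrod M" and "n \<ge> 1"
  shows "Sq M (2 ^ (n + 1)) * milnor_P M n =
    milnor_P M (n + 1) + dual_elem M (xis M 1 ^ 2 ^ n * xis M n)
    + scalar M (tau M) * (\<Sum>i = 0..n - 1. scalar M (rho M) ^ i
        * prod_list (map (milnor_Q M) [n - i - 1..<n + 1]) * Sq M (2 ^ (n - i)))
    + scalar M (tau M) * scalar M (rho M) * (\<Sum>i = 0..n - 1. scalar M (rho M) ^ i
        * prod_list (map (milnor_Q M) [n - i - 1..<n + 1]) * milnor_Q M 0 * Sq M (2 ^ (n - i) - 2))"
proof (cases "(1::'h) = 0")
  case True
  interpret motivic_steenrod M by fact
  \<comment> \<open>If \<open>1 = 0\<close> in the cohomology of the base, the Steenrod algebra is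
    the zero ring.\<close>
  have "a = 0" for a :: 'a
  proof -
    have "scalar M 1 * a = scalar M 0 * a"
      by (simp only: True)
    then show ?thesis by simp
  qed
  then show ?thesis by metis
next
  case False
  interpret nontrivial_motivic_steenrod M
    using assms(1) False by (simp add: nontrivial_motivic_steenrod_def nontrivial_motivic_steenrod_axioms_def)
  define dual where "dual E R = dual_elem M (monomial M (E, R))" for E R
  have P: "milnor_P M (n + 1) = dual {} ((\<lambda>_. 0)(n + 1 := 1))"
    unfolding dual_def milnor_P_def by (subst xis_eq_monomial) simp
  have xi: "dual_elem M (xis M 1 ^ 2 ^ n * xis M n)
      = dual {} (((\<lambda>_. 0)(1 := 2 ^ n))(n := Suc (((\<lambda>_. 0)(1 := 2 ^ n)) n)))"
    unfolding dual_def xis_1_power mult.commute[of _ "xis M n"]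
    by (subst xis_mult_monomial) simp_all
  have upto: "{e..<n + 1} = {e..n}" for e
    by auto
  have Q_Sq: "prod_list (map (milnor_Q M) [e..<n + 1]) * Sq M (2 ^ (e + 1))
      = dual {e..n} ((\<lambda>_. 0)(1 := 2 ^ e))" for e
  proof -
    have "Sq M (2 ^ (e + 1)) = dual {} ((\<lambda>_. 0)(1 := 2 ^ e))"
      by (simp only: Sq_power_two dual_def)
    then show ?thesis
      unfolding dual_def
      by (simp add: prod_list_milnor_Q_mult_dual upto del: upt_Suc One_nat_def fun_upd_apply)
  qed
  \<comment> \<open>For \<open>e = 0\<close> the list already contains \<open>Q\<^sub>0\<close>, so
    the term vanishes.\<close>
  have Q_Q0_Sq: "prod_list (map (milnor_Q M) [e..<n + 1]) * milnor_Q M 0 * Sq M (2 ^ (e + 1) - 2)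
      = (if e \<ge> 1 then dual (insert 0 {e..n}) ((\<lambda>_. 0)(1 := 2 ^ e - 1)) else 0)" for e
  proof -
    have "(2::nat) ^ (e + 1) - 2 = 2 * (2 ^ e - 1)"
      by (simp add: diff_mult_distrib2)
    then have "Sq M (2 ^ (e + 1) - 2) = dual {} ((\<lambda>_. 0)(1 := 2 ^ e - 1))"
      by (simp only: Sq_even dual_def xis_1_power)
    moreover have "milnor_Q M 0 * dual {} ((\<lambda>_. 0)(1 := 2 ^ e - 1)) = dual {0} ((\<lambda>_. 0)(1 := 2 ^ e - 1))"
      unfolding dual_def by (subst milnor_Q_mult_dual) simp_all
    moreover have "prod_list (map (milnor_Q M) [e..<n + 1]) * dual {0} ((\<lambda>_. 0)(1 := 2 ^ e - 1))
        = (if e \<ge> 1 then dual (insert 0 {e..n}) ((\<lambda>_. 0)(1 := 2 ^ e - 1)) else 0)"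
      unfolding dual_def
      by (subst prod_list_milnor_Q_mult_dual)
        (auto simp: upto Suc_le_eq simp del: upt_Suc One_nat_def fun_upd_apply)
    ultimately show ?thesis
      by (simp only: mult.assoc)
  qed
  have range: "{0..n - 1} = {..<n}"
    using assms(2) by auto
  have exponents: "i = n - 1 - (n - Suc i)" "n - i - 1 = n - Suc i" "n - i = n - Suc i + 1" if "i < n" for i
    using that by auto
  \<comment> \<open>The sum is reindexed by the least index \<open>e = n - 1 - i\<close> of the
    chain.\<close>
  have sum1: "(\<Sum>i = 0..n - 1. scalar M (rho M) ^ i
        * prod_list (map (milnor_Q M) [n - i - 1..<n + 1]) * Sq M (2 ^ (n - i)))
      = (\<Sum>e<n. scalar M (rho M) ^ (n - 1 - e) * dual {e..n} ((\<lambda>_. 0)(1 := 2 ^ e)))"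
  proof -
    have "(\<Sum>i = 0..n - 1. scalar M (rho M) ^ i
        * prod_list (map (milnor_Q M) [n - i - 1..<n + 1]) * Sq M (2 ^ (n - i)))
      = (\<Sum>i<n. scalar M (rho M) ^ (n - 1 - (n - Suc i)) * dual {n - Suc i..n} ((\<lambda>_. 0)(1 := 2 ^ (n - Suc i))))"
      unfolding range Q_Sq[symmetric] mult.assoc using exponents by (intro sum.cong) auto
    then show ?thesis
      by (simp only: sum.nat_diff_reindex[of "\<lambda>e. scalar M (rho M) ^ (n - 1 - e) * dual {e..n} ((\<lambda>_. 0)(1 := 2 ^ e))"])
  qed
  have sum2: "(\<Sum>i = 0..n - 1. scalar M (rho M) ^ i
        * prod_list (map (milnor_Q M) [n - i - 1..<n + 1]) * milnor_Q M 0 * Sq M (2 ^ (n - i) - 2))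
      = (\<Sum>e<n. scalar M (rho M) ^ (n - 1 - e)
        * (if e \<ge> 1 then dual (insert 0 {e..n}) ((\<lambda>_. 0)(1 := 2 ^ e - 1)) else 0))"
  proof -
    have "(\<Sum>i = 0..n - 1. scalar M (rho M) ^ i
        * prod_list (map (milnor_Q M) [n - i - 1..<n + 1]) * milnor_Q M 0 * Sq M (2 ^ (n - i) - 2))
      = (\<Sum>i<n. scalar M (rho M) ^ (n - 1 - (n - Suc i))
        * (if n - Suc i \<ge> 1 then dual (insert 0 {n - Suc i..n}) ((\<lambda>_. 0)(1 := 2 ^ (n - Suc i) - 1)) else 0))"
      unfolding range Q_Q0_Sq[symmetric] mult.assoc using exponents by (intro sum.cong) auto
    then show ?thesis
      by (simp only: sum.nat_diff_reindex[of "\<lambda>e. scalar M (rho M) ^ (n - 1 - e)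
        * (if e \<ge> 1 then dual (insert 0 {e..n}) ((\<lambda>_. 0)(1 := 2 ^ e - 1)) else 0)"])
  qed
  show ?thesis
    unfolding sum1 sum2 P xi
  proof (rule steenrod_eqI)
    fix m assume "m \<in> monomial_indices"
    then obtain E R where m: "m = (E, R)" "(E, R) \<in> monomial_indices"
      by (cases m) auto
    have pairing_dual: "pairing M (monomial M (E, R)) (dual E' R') = (if E = E' \<and> R = R' then 1 else 0)"
      if "(E', R') \<in> monomial_indices" for E' R'
      using that m(2) by (simp add: dual_def coef_monomial)
    have pairing_scalar_power: "pairing M \<alpha> (scalar M x ^ k * \<theta>) = x ^ k * pairing M \<alpha> \<theta>" for \<alpha> x k \<theta>
      by (metis pairing_scalar scalar_hom unital_ring_hom_power)
    have idx: "({}, ((\<lambda>_. 0)(1 := 2 ^ n))(n := Suc (((\<lambda>_. 0)(1 := 2 ^ n)) n))) \<in> monomial_indices"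
      by (intro indices_update indices_single assms(2)) simp_all
    have "pairing M (monomial M m) (Sq M (2 ^ (n + 1)) * milnor_P M n)
      = (if E = {} \<and> R = (\<lambda>_. 0)(n + 1 := 1) then 1 else 0)
      + (if E = {} \<and> R = ((\<lambda>_. 0)(1 := 2 ^ n))(n := Suc (((\<lambda>_. 0)(1 := 2 ^ n)) n)) then 1 else 0)
      + tau M * (\<Sum>e<n. rho M ^ (n - 1 - e) * (if E = {e..n} \<and> R = (\<lambda>_. 0)(1 := 2 ^ e) then 1 else 0))
      + tau M * (rho M * (\<Sum>e<n. rho M ^ (n - 1 - e)
          * (if e \<ge> 1 \<and> E = insert 0 {e..n} \<and> R = (\<lambda>_. 0)(1 := 2 ^ e - 1) then 1 else 0)))"
    proof -
      \<comment> \<open>This splits off the \<open>\<rho>\<close> that stands in front of the second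
        sum.\<close>
      have "rho M ^ (n - e) = rho M * rho M ^ (n - 1 - e)" if "e < n" for e
      proof -
        have "n - e = Suc (n - 1 - e)"
          using that by simp
        then show ?thesis
          by simp
      qed
      then show ?thesis
        unfolding m(1) coef_milnor_expansion[OF assms(2) m(2)] sum_distrib_left
        by (auto intro!: arg_cong2[of _ _ _ _ "(+)"] sum.cong simp: mult_ac)
    qed
    also have "\<dots> = pairing M (monomial M m) (dual {} ((\<lambda>_. 0)(n + 1 := 1))
      + dual {} (((\<lambda>_. 0)(1 := 2 ^ n))(n := Suc (((\<lambda>_. 0)(1 := 2 ^ n)) n)))
      + scalar M (tau M) * (\<Sum>e<n. scalar M (rho M) ^ (n - 1 - e) * dual {e..n} ((\<lambda>_. 0)(1 := 2 ^ e)))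
      + scalar M (tau M) * scalar M (rho M) * (\<Sum>e<n. scalar M (rho M) ^ (n - 1 - e)
        * (if e \<ge> 1 then dual (insert 0 {e..n}) ((\<lambda>_. 0)(1 := 2 ^ e - 1)) else 0)))"
    proof -
      have "pairing M (monomial M (E, R)) (if e \<ge> 1 then dual (insert 0 {e..n}) ((\<lambda>_. 0)(1 := 2 ^ e - 1)) else 0)
          = (if e \<ge> 1 \<and> E = insert 0 {e..n} \<and> R = (\<lambda>_. 0)(1 := 2 ^ e - 1) then 1 else 0)" for e
        using pairing_dual[of "insert 0 {e..n}" "(\<lambda>_. 0)(1 := 2 ^ e - 1)"] by (auto simp del: One_nat_def fun_upd_apply)
      then show ?thesis
        unfolding m(1) mult.assoc[of "scalar M (tau M)"] pairing_add_right pairing_scalar pairing_sum_right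
          pairing_scalar_power
        using idx by (simp add: pairing_dual del: One_nat_def fun_upd_apply)
    qed
    finally show "pairing M (monomial M m) (Sq M (2 ^ (n + 1)) * milnor_P M n) = \<dots>" .
  qed
qed

end
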